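(* There exists a universal constant $c>0$ such that the following holds. Let $d,r$ be integers with $1\le r\le d/2$, let $a$ be a positive integer, let $\varepsilon\in(0,1)$ and $\alpha>0$, and let $\lambda\le\alpha$ be a number that occurs as the largest eigenvalue of some rank-$r$ quantum state on $\mathbb{C}^d$. Suppose a $Q$-query algorithm has the property that, for every rank-$r$ quantum state $\rho$ on $\mathbb{C}^d$ with largest eigenvalue $\lambda_{\max}(\rho)=\lambda$ and every $(\alpha,a,0)$-block encoding $U_\rho$ of $\rho$, when given query access to $\mathcal{U}_\rho$ and $\mathcal{U}_\rho^\dagger$ it outputs a state $\hat\rho$ with $\|\hat\rho-\rho\|_1\le\varepsilon$. Then $$Q\ \ge\ c\,\frac{\alpha}{\lambda}\sqrt{\frac{d}{r}}\,(1-\varepsilon).$$ That is, state recovery of an unknown rank-$r$ state $\rho$ with trace-norm error at most $\varepsilon$ requires $\Omega\!\left(\frac{\alpha}{\lambda_{\max}(\rho)}\sqrt{\frac{d}{r}}(1-\varepsilon)\right)$ queries in total to $\mathcal{U}_\rho$ and $\mathcal{U}_\rho^\dagger$ in the worst case.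
   Context: Block encoding: a unitary $U$ on $(\mathbb{C}^2)^{\otimes a}\otimes\mathbb{C}^d$ is an $(\alpha,a,0)$-block encoding of an operator $A$ on $\mathbb{C}^d$ if $\alpha(\langle 0|^{\otimes a}\otimes I)U(|0\rangle^{\otimes a}\otimes I)=A$. For a unitary $U_\rho$, put $\mathcal{U}_\rho(\cdot)=U_\rho(\cdot)U_\rho^\dagger$ and $\mathcal{U}_\rho^\dagger(\cdot)=U_\rho^\dagger(\cdot)U_\rho$; $\mathcal{U}_\rho^{(+)}=\mathcal{U}_\rho$, $\mathcal{U}_\rho^{(-)}=\mathcal{U}_\rho^\dagger$. $\|\cdot\|_1$ is the trace norm. A $Q$-query algorithm consists of a finite-dimensional environment system $E$, a fixed initial state $|\mathrm{init}\rangle\in\mathbb{C}^d$, fixed signs $s_1,\dots,s_Q\in\{+,-\}$, and unitary channels $\mathcal{C}_0,\dots,\mathcal{C}_Q$ on $E\otimes A\otimes X$, where $A=(\mathbb{C}^2)^{\otimes a}$ and $X=\mathbb{C}^d$, all independent of $\rho$ and $U_\rho$. Its output is the state on $X$ $$\hat\rho=\mathrm{Tr}_{EA}\left[\left(\mathcal{C}_Q\circ\mathcal{U}_\rho^{(s_Q)}\circ\mathcal{C}_{Q-1}\circ\cdots\circ\mathcal{C}_1\circ\mathcal{U}_\rho^{(s_1)}\circ\mathcal{C}_0\right)\left[|0\rangle\langle0|_E\otimes|0\rangle\langle0|_A^{\otimes a}\otimes|\mathrm{init}\rangle\langle\mathrm{init}|_X\right]\right],$$ where each $\mathcal{U}_\rho^{(s_i)}$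 acts on $A\otimes X$ (and as the identity on $E$). *)

theory Defs
  imports
    "Jordan_Normal_Form.Schur_Decomposition"
    "Jordan_Normal_Form.DL_Rank"
begin

text \<open>
  Operators on \<open>\<complex>\<^sup>n\<close> are complex matrices in \<^term>\<open>carrier_mat n n\<close>. In a tensor product the left
  factor is the most significant one: the basis vector \<open>|k\<rangle> \<otimes> |i\<rangle>\<close> of \<open>\<complex>\<^sup>m \<otimes> \<complex>\<^sup>n\<close> has index
  \<^term>\<open>k * n + i\<close>. In particular \<open>|0\<rangle>\<close> tensored with itself \<open>a\<close> times is \<^term>\<open>unit_vec (2 ^ a) 0\<close>.
\<close>

definition kron :: "complex mat \<Rightarrow> complex mat \<Rightarrow> complex mat" where
  "kron A B = mat (dim_row A * dim_row B) (dim_col A * dim_col B)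
     (\<lambda>(i, j). A $$ (i div dim_row B, j div dim_col B) * B $$ (i mod dim_row B, j mod dim_col B))"

definition ket :: "complex vec \<Rightarrow> complex mat" where
  "ket v = mat_of_cols (dim_vec v) [v]"

definition bra :: "complex vec \<Rightarrow> complex mat" where
  "bra v = mat_adjoint (ket v)"

definition unitary_mat :: "nat \<Rightarrow> complex mat \<Rightarrow> bool" where
  "unitary_mat n U \<longleftrightarrow>
     U \<in> carrier_mat n n \<and> mat_adjoint U * U = 1\<^sub>m n \<and> U * mat_adjoint U = 1\<^sub>m n"

text \<open>In the order on \<^typ>\<open>complex\<close>, \<^term>\<open>0 \<le> (z :: complex)\<close> says that \<open>z\<close> is real and nonnegative.\<close>

definition psd_mat :: "nat \<Rightarrow> complex mat \<Rightarrow> bool" where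
  "psd_mat n A \<longleftrightarrow>
     A \<in> carrier_mat n n \<and> mat_adjoint A = A \<and> (\<forall>v \<in> carrier_vec n. 0 \<le> (A *\<^sub>v v) \<bullet>c v)"

definition mat_trace :: "complex mat \<Rightarrow> complex" where
  "mat_trace A = (\<Sum>i<dim_row A. A $$ (i, i))"

text \<open>A positive semidefinite matrix has exactly one positive semidefinite square root.\<close>

definition psd_sqrt :: "complex mat \<Rightarrow> complex mat" where
  "psd_sqrt A = (THE S. psd_mat (dim_row A) S \<and> S * S = A)"

definition trace_norm :: "complex mat \<Rightarrow> real" where
  "trace_norm A = Re (mat_trace (psd_sqrt (mat_adjoint A * A)))"

definition partial_trace_left :: "nat \<Rightarrow> nat \<Rightarrow> complex mat \<Rightarrow> complex mat" where
  "partial_trace_left m n M = mat n n (\<lambda>(i, j). \<Sum>k<m. M $$ (k * n + i, k * n + j))"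

definition quantum_state :: "nat \<Rightarrow> complex mat \<Rightarrow> bool" where
  "quantum_state d \<rho> \<longleftrightarrow> psd_mat d \<rho> \<and> mat_trace \<rho> = 1"

definition rank_state :: "nat \<Rightarrow> nat \<Rightarrow> complex mat \<Rightarrow> bool" where
  "rank_state d r \<rho> \<longleftrightarrow> quantum_state d \<rho> \<and> vec_space.rank d \<rho> = r"

text \<open>Only meaningful for Hermitian matrices, all of whose eigenvalues are real.\<close>

definition lambda_max :: "complex mat \<Rightarrow> real" where
  "lambda_max \<rho> = Max {x :: real. eigenvalue \<rho> (complex_of_real x)}"

definition block_encoding :: "real \<Rightarrow> nat \<Rightarrow> nat \<Rightarrow> complex mat \<Rightarrow> complex mat \<Rightarrow> bool" where
  "block_encoding \<alpha> a d U A \<longleftrightarrow>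
     unitary_mat (2 ^ a * d) U \<and>
     complex_of_real \<alpha> \<cdot>\<^sub>m
       (kron (bra (unit_vec (2 ^ a) 0)) (1\<^sub>m d) * U * kron (ket (unit_vec (2 ^ a) 0)) (1\<^sub>m d)) = A"

definition unitary_channel :: "complex mat \<Rightarrow> complex mat \<Rightarrow> complex mat" where
  "unitary_channel U X = U * X * mat_adjoint U"

datatype query_sign = Plus | Minus

fun signed :: "query_sign \<Rightarrow> complex mat \<Rightarrow> complex mat" where
  "signed Plus U = U"
| "signed Minus U = mat_adjoint U"

text \<open>
  \<open>signs\<close> is used at the indices \<open>1, \<dots>, Q\<close> and \<open>gates\<close> at \<open>0, \<dots>, Q\<close>; the unitary channel
  \<open>\<C>\<^sub>i\<close> is given by the unitary matrix \<open>gates i\<close>.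
\<close>

record query_alg =
  env_dim :: nat
  init_vec :: "complex vec"
  signs :: "nat \<Rightarrow> query_sign"
  gates :: "nat \<Rightarrow> complex mat"

definition query_algorithm :: "nat \<Rightarrow> nat \<Rightarrow> nat \<Rightarrow> query_alg \<Rightarrow> bool" where
  "query_algorithm a d Q alg \<longleftrightarrow>
     0 < env_dim alg \<and>
     init_vec alg \<in> carrier_vec d \<and> init_vec alg \<bullet>c init_vec alg = 1 \<and>
     (\<forall>i\<le>Q. unitary_mat (env_dim alg * (2 ^ a * d)) (gates alg i))"

definition pure_state :: "complex vec \<Rightarrow> complex mat" where
  "pure_state v = ket v * bra v"

definition initial_state :: "nat \<Rightarrow> query_alg \<Rightarrow> complex mat" where
  "initial_state a alg =
     kron (pure_state (unit_vec (env_dim alg) 0))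
       (kron (pure_state (unit_vec (2 ^ a) 0)) (pure_state (init_vec alg)))"

definition query_channel :: "query_alg \<Rightarrow> complex mat \<Rightarrow> nat \<Rightarrow> complex mat \<Rightarrow> complex mat" where
  "query_channel alg U i = unitary_channel (kron (1\<^sub>m (env_dim alg)) (signed (signs alg i) U))"

text \<open>The state on \<open>E \<otimes> A \<otimes> X\<close> right after the application of \<open>\<C>\<^sub>i\<close>.\<close>

primrec state_after :: "nat \<Rightarrow> query_alg \<Rightarrow> complex mat \<Rightarrow> nat \<Rightarrow> complex mat" where
  "state_after a alg U 0 = unitary_channel (gates alg 0) (initial_state a alg)"
| "state_after a alg U (Suc i) =
     unitary_channel (gates alg (Suc i)) (query_channel alg U (Suc i) (state_after a alg U i))"

definition alg_output :: "nat \<Rightarrow> nat \<Rightarrow> nat \<Rightarrow> query_alg \<Rightarrow> complex mat \<Rightarrow> complex mat" where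
  "alg_output a d Q alg U = partial_trace_left (env_dim alg * 2 ^ a) d (state_after a alg U Q)"

end

theory Submission
  imports Defs "HOL-Analysis.L2_Norm" "Jordan_Normal_Form.DL_Rank_Submatrix"
begin

text \<open>
  Hybrid argument. Given the spectrum of some admissible state, place it on one of the
  \<open>\<lfloor>d / r\<rfloor>\<close> disjoint blocks of \<open>r\<close> coordinates; this yields diagonal states \<open>\<rho>\<^sub>x\<close>. Each
  \<open>\<rho>\<^sub>x\<close> has a Hermitian unitary block encoding \<open>U\<^sub>x\<close>, a direct sum of two-dimensional reflections,
  so that a query to the inverse is the same as a query to \<open>U\<^sub>x\<close>. It differs from the encoding
  \<open>U\<^sub>0\<close> of the zero matrix only on block \<open>x\<close>, where the distance is at most
  \<open>\<kappa> = \<surd>2 \<lambda> / \<alpha>\<close>. Hence the final states for \<open>U\<^sub>x\<close> and \<open>U\<^sub>0\<close> differ by at most \<open>\<kappa>\<close> times the sum over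
  the queries of the norm of the block-\<open>x\<close> component of the run with \<open>U\<^sub>0\<close>. By Cauchy-Schwarz these
  norms sum to at most \<open>\<surd>k\<close> over the \<open>k\<close> blocks, for every query. On the other hand the output
  for \<open>U\<^sub>x\<close> has weight at least \<open>1 - \<epsilon> / 2\<close> on block \<open>x\<close>, while for \<open>U\<^sub>0\<close> the weights of all blocks
  sum to at most \<open>1\<close>. Therefore \<open>k (1 - \<epsilon> / 2) \<le> 1 + 2 \<kappa> Q \<surd>k\<close>.
\<close>

section \<open>Matrices and the spectral theorem\<close>

lemma dim_mat_adjoint [simp]:
  "dim_row (mat_adjoint A) = dim_col A" "dim_col (mat_adjoint A) = dim_row A"
  by (simp_all add: mat_adjoint_def)

lemma carrier_mat_adjoint [simp]:
  "A \<in> carrier_mat n m \<Longrightarrow> mat_adjoint A \<in> carrier_mat m n"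
  by (auto intro: carrier_matI)

lemma index_mat_adjoint [simp]:
  fixes A :: "complex mat"
  shows "i < dim_col A \<Longrightarrow> j < dim_row A \<Longrightarrow> mat_adjoint A $$ (i, j) = cnj (A $$ (j, i))"
  by (simp add: mat_adjoint_def mat_of_rows_def)

lemma mat_adjoint_adjoint [simp]:
  fixes A :: "complex mat"
  shows "mat_adjoint (mat_adjoint A) = A"
  by (intro eq_matI) auto

lemma mat_adjoint_one [simp]: "mat_adjoint (1\<^sub>m n :: complex mat) = 1\<^sub>m n"
  by (intro eq_matI) auto

lemma index_mult_mat_sum:
  "A \<in> carrier_mat n m \<Longrightarrow> B \<in> carrier_mat m l \<Longrightarrow> i < n \<Longrightarrow> j < l \<Longrightarrow>
    (A * B) $$ (i, j) = (\<Sum>k<m. A $$ (i, k) * B $$ (k, j))"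
  by (simp add: scalar_prod_def atLeast0LessThan)

lemma index_mult_mat_vec_sum:
  "A \<in> carrier_mat n m \<Longrightarrow> v \<in> carrier_vec m \<Longrightarrow> i < n \<Longrightarrow>
    (A *\<^sub>v v) $ i = (\<Sum>k<m. A $$ (i, k) * v $ k)"
  by (simp add: scalar_prod_def atLeast0LessThan)

lemma mult_carrier_mat_square [simp]:
  "A \<in> carrier_mat n n \<Longrightarrow> B \<in> carrier_mat n m \<Longrightarrow> A * B \<in> carrier_mat n m"
  by (rule mult_carrier_mat)

lemma mult_mat_vec_carrier_square [simp]:
  "A \<in> carrier_mat n n \<Longrightarrow> v \<in> carrier_vec n \<Longrightarrow> A *\<^sub>v v \<in> carrier_vec n"
  by (rule mult_mat_vec_carrier)

lemma mat_adjoint_mult: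
  fixes A B :: "complex mat"
  assumes "A \<in> carrier_mat n m" "B \<in> carrier_mat m l"
  shows "mat_adjoint (A * B) = mat_adjoint B * mat_adjoint A"
proof (intro eq_matI)
  fix i j assume "i < dim_row (mat_adjoint B * mat_adjoint A)"
    "j < dim_col (mat_adjoint B * mat_adjoint A)"
  then have ij: "i < l" "j < n" using assms by auto
  have "mat_adjoint (A * B) $$ (i, j) = cnj ((A * B) $$ (j, i))"
    using ij assms by (intro index_mat_adjoint) auto
  also have "\<dots> = (mat_adjoint B * mat_adjoint A) $$ (i, j)"
    using ij assms
    by (subst (1 2) index_mult_mat_sum) (auto intro!: sum.cong simp: mult.commute)
  finally show "mat_adjoint (A * B) $$ (i, j) = (mat_adjoint B * mat_adjoint A) $$ (i, j)" .
qed (use assms in auto)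

lemma unitary_matD:
  assumes "unitary_mat n U"
  shows "U \<in> carrier_mat n n" "mat_adjoint U \<in> carrier_mat n n"
    "mat_adjoint U * U = 1\<^sub>m n" "U * mat_adjoint U = 1\<^sub>m n"
  using assms by (auto simp: unitary_mat_def)

text \<open>A one-sided inverse of a square matrix is two-sided, so half of the definition
  suffices.\<close>

lemma unitary_matI:
  assumes "U \<in> carrier_mat n n" "mat_adjoint U * U = 1\<^sub>m n"
  shows "unitary_mat n U"
  using assms mat_mult_left_right_inverse[of "mat_adjoint U" n U] by (auto simp: unitary_mat_def)

lemma unitary_mat_one: "unitary_mat n (1\<^sub>m n)"
  by (rule unitary_matI) auto

lemma unitary_mat_adjoint: "unitary_mat n U \<Longrightarrow> unitary_mat n (mat_adjoint U)"
  by (auto simp: unitary_mat_def)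

lemma unitary_mat_mult:
  assumes "unitary_mat n U" "unitary_mat n V"
  shows "unitary_mat n (U * V)"
proof (rule unitary_matI)
  note U = unitary_matD[OF assms(1)] and V = unitary_matD[OF assms(2)]
  show "U * V \<in> carrier_mat n n" using U V by auto
  have "mat_adjoint (U * V) * (U * V) = mat_adjoint V * (mat_adjoint U * (U * V))"
    using U V by (subst mat_adjoint_mult) (auto intro!: assoc_mult_mat)
  also have "mat_adjoint U * (U * V) = (mat_adjoint U * U) * V"
    using U V by (intro assoc_mult_mat[symmetric]) auto
  finally show "mat_adjoint (U * V) * (U * V) = 1\<^sub>m n"
    using U V by auto
qed

lemma unitary_mat_cols:
  assumes "unitary_mat n U" "i < n" "j < n"
  shows "(\<Sum>k<n. cnj (U $$ (k, i)) * U $$ (k, j)) = (if i = j then 1 else 0)"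
proof -
  note U = unitary_matD[OF assms(1)]
  have "(\<Sum>k<n. cnj (U $$ (k, i)) * U $$ (k, j)) = (mat_adjoint U * U) $$ (i, j)"
    using U assms by (subst index_mult_mat_sum[of _ n n _ n]) (auto intro!: sum.cong)
  then show ?thesis using U assms by auto
qed

section \<open>Diagonal matrices and unitary conjugation\<close>

definition diag_of :: "nat \<Rightarrow> (nat \<Rightarrow> complex) \<Rightarrow> complex mat" where
  "diag_of n f = mat n n (\<lambda>(i, j). if i = j then f i else 0)"

lemma carrier_diag_of [simp]: "diag_of n f \<in> carrier_mat n n"
  and dim_diag_of [simp]: "dim_row (diag_of n f) = n" "dim_col (diag_of n f) = n"
  and index_diag_of [simp]:
    "i < n \<Longrightarrow> j < n \<Longrightarrow> diag_of n f $$ (i, j) = (if i = j then f i else 0)"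
  by (simp_all add: diag_of_def)

lemma index_mult_diag_of:
  assumes "A \<in> carrier_mat m n" "i < m" "j < n"
  shows "(A * diag_of n f) $$ (i, j) = A $$ (i, j) * f j"
proof -
  have "(A * diag_of n f) $$ (i, j) = (\<Sum>k<n. A $$ (i, k) * diag_of n f $$ (k, j))"
    using assms by (intro index_mult_mat_sum) auto
  also have "\<dots> = (\<Sum>k<n. if k = j then A $$ (i, j) * f j else 0)"
    using assms by (intro sum.cong) auto
  finally have "(A * diag_of n f) $$ (i, j) = (\<Sum>k<n. if k = j then A $$ (i, j) * f j else 0)" .
  then show ?thesis using assms by simp
qed

lemma index_diag_of_mult:
  assumes "A \<in> carrier_mat n m" "i < n" "j < m"
  shows "(diag_of n f * A) $$ (i, j) = f i * A $$ (i, j)"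
proof -
  have "(diag_of n f * A) $$ (i, j) = (\<Sum>k<n. diag_of n f $$ (i, k) * A $$ (k, j))"
    using assms by (intro index_mult_mat_sum) auto
  also have "\<dots> = (\<Sum>k<n. if k = i then f i * A $$ (i, j) else 0)"
    using assms by (intro sum.cong) auto
  finally have "(diag_of n f * A) $$ (i, j) = (\<Sum>k<n. if k = i then f i * A $$ (i, j) else 0)" .
  then show ?thesis using assms by simp
qed

lemma diag_of_mult: "diag_of n f * diag_of n g = diag_of n (\<lambda>i. f i * g i)"
  by (intro eq_matI) (auto simp: index_mult_diag_of[of _ n n] simp del: index_mult_mat(1))

lemma mat_adjoint_diag_of: "mat_adjoint (diag_of n f) = diag_of n (\<lambda>i. cnj (f i))"
  by (intro eq_matI) auto

lemma diag_of_one: "diag_of n (\<lambda>_. 1) = 1\<^sub>m n"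
  by (intro eq_matI) auto

lemma unitary_mat_cancel:
  assumes "unitary_mat n U" "X \<in> carrier_mat n m"
  shows "U * (mat_adjoint U * X) = X" "mat_adjoint U * (U * X) = X"
  using unitary_matD[OF assms(1)] assms(2)
    assoc_mult_mat[of U n n "mat_adjoint U" n X m] assoc_mult_mat[of "mat_adjoint U" n n U n X m]
  by auto

lemma unitary_conj_mult:
  assumes U: "unitary_mat n U" and A: "A \<in> carrier_mat n n" and B: "B \<in> carrier_mat n n"
  shows "(U * A * mat_adjoint U) * (U * B * mat_adjoint U) = U * (A * B) * mat_adjoint U"
  using unitary_matD(1,2)[OF U] A B
  by (simp add: assoc_mult_mat[of _ n n _ n _ n] unitary_mat_cancel[OF U, of _ n])

lemma unitary_conj_inverse:
  assumes U: "unitary_mat n U" and A: "A \<in> carrier_mat n n"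
  shows "U * (mat_adjoint U * A * U) * mat_adjoint U = A"
  using unitary_matD[OF U] A
  by (simp add: assoc_mult_mat[of _ n n _ n _ n] unitary_mat_cancel[OF U, of _ n])

lemma mat_adjoint_conj:
  fixes U A :: "complex mat"
  assumes "U \<in> carrier_mat n n" "A \<in> carrier_mat n n"
  shows "mat_adjoint (U * A * mat_adjoint U) = U * mat_adjoint A * mat_adjoint U"
  using assms
  by (simp add: mat_adjoint_mult[of _ n n _ n] assoc_mult_mat[of _ n n _ n _ n])

section \<open>Inner products and unitary diagonalisation of Hermitian matrices\<close>

lemma cscalar_prod_eq_sum:
  "w \<in> carrier_vec n \<Longrightarrow> v \<in> carrier_vec n \<Longrightarrow> v \<bullet>c w = (\<Sum>k<n. v $ k * cnj (w $ k))"
  by (auto simp: scalar_prod_def atLeast0LessThan intro!: sum.cong)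

lemma cscalar_prod_self:
  "v \<in> carrier_vec n \<Longrightarrow> v \<bullet>c v = complex_of_real (\<Sum>k<n. (cmod (v $ k))\<^sup>2)"
  by (simp add: cscalar_prod_eq_sum complex_norm_square del: of_real_power)

text \<open>Complete \<open>v\<close> to a basis, orthogonalise it by Gram-Schmidt, which keeps
  \<open>v\<close> in front, and normalise the columns. The scalar \<open>c\<close> is the
  normalisation of \<open>v\<close>; for an eigenvector, proportionality is enough.\<close>

lemma unitary_extension:
  fixes v :: "complex vec"
  assumes v: "v \<in> carrier_vec n" and v0: "v \<noteq> 0\<^sub>v n" and n: "n \<noteq> 0"
  obtains W c where "unitary_mat n W" "\<And>i. i < n \<Longrightarrow> W $$ (i, 0) = c * v $ i"
proof -
  interpret cof_vec_space n "TYPE(complex)" .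
  define b where "b = basis_completion v"
  define ws where "ws = gram_schmidt n b"
  note bc = basis_completion[OF v v0, folded b_def]
  from bc n obtain vs where bv: "b = v # vs" by (cases b) auto
  from gram_schmidt_result[OF bc(2,4,5) refl, folded ws_def]
  have ws: "set ws \<subseteq> carrier_vec n" "corthogonal ws" "length ws = n"
    using bc(6) by auto
  have hdws: "hd ws = v" using gram_schmidt_hd[OF v, of vs, folded bv] by (simp add: ws_def)
  have ws0: "ws ! 0 = v" using hdws ws(3) n by (cases ws) auto
  have wsc: "ws ! i \<in> carrier_vec n" if "i < n" for i using ws that by auto
  define N where "N i = (\<Sum>k<n. (cmod (ws ! i $ k))\<^sup>2)" for i
  have N: "ws ! i \<bullet>c ws ! i = complex_of_real (N i)" if "i < n" for i
    using cscalar_prod_self[OF wsc[OF that]] by (simp add: N_def)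
  have Npos: "N i > 0" if "i < n" for i
  proof -
    have "ws ! i \<bullet>c ws ! i \<noteq> 0" using corthogonalD[OF ws(2)] ws(3) that by auto
    then have "N i \<noteq> 0" using N[OF that] by auto
    moreover have "N i \<ge> 0" by (auto simp: N_def intro: sum_nonneg)
    ultimately show ?thesis by simp
  qed
  \<comment> \<open>The vectors in \<open>ws\<close> are orthogonal with squared norms
    \<open>N i\<close>; these factors make them orthonormal.\<close>
  define s where "s i = complex_of_real (1 / sqrt (N i))" for i
  define W where "W = mat n n (\<lambda>(i, j). s j * ws ! j $ i)"
  have W: "W \<in> carrier_mat n n" by (simp add: W_def)
  have "mat_adjoint W * W = 1\<^sub>m n"
  proof (intro eq_matI)
    fix i j assume "i < dim_row (1\<^sub>m n :: complex mat)" "j < dim_col (1\<^sub>m n :: complex mat)"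
    then have ij: "i < n" "j < n" by auto
    have "(mat_adjoint W * W) $$ (i, j) = (\<Sum>k<n. cnj (s i * ws ! i $ k) * (s j * ws ! j $ k))"
      using W ij by (subst index_mult_mat_sum[of _ n n _ n]) (auto intro!: sum.cong simp: W_def)
    also have "\<dots> = s i * s j * (ws ! j \<bullet>c ws ! i)"
      using ij wsc by (subst cscalar_prod_eq_sum[of _ n])
        (auto simp: sum_distrib_left s_def intro!: sum.cong)
    also have "\<dots> = (1\<^sub>m n) $$ (i, j)"
    proof (cases "i = j")
      case True
      then show ?thesis using Npos[OF ij(1)] N[OF ij(1)] ij
        by (simp add: s_def flip: of_real_mult)
    next
      case False
      then show ?thesis using corthogonalD[OF ws(2)] ws(3) ij by auto
    qed
    finally show "(mat_adjoint W * W) $$ (i, j) = (1\<^sub>m n) $$ (i, j)" .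
  qed (use W in auto)
  then have "unitary_mat n W" by (intro unitary_matI W)
  moreover have "W $$ (i, 0) = s 0 * v $ i" if "i < n" for i
    using that n by (simp add: W_def ws0)
  ultimately show thesis by (rule that)
qed

text \<open>Induction on the dimension. An eigenvector exists because the characteristic polynomial
  splits over the complex numbers. Conjugation by a unitary with this eigenvector as first column,
  up to a scalar, clears the rest of the first column; Hermiticity clears the first row, and the
  remaining \<open>n\<close>-dimensional block is again Hermitian.\<close>

theorem hermitian_spectral:
  assumes "A \<in> carrier_mat n n" "mat_adjoint A = A"
  shows "\<exists>U (D :: nat \<Rightarrow> real). unitary_mat n U \<and>
    A = U * diag_of n (\<lambda>i. complex_of_real (D i)) * mat_adjoint U"
  using assms
proof (induction n arbitrary: A)
  case 0
  have "A = 1\<^sub>m 0 * diag_of 0 (\<lambda>i. complex_of_real 0) * mat_adjoint (1\<^sub>m 0)"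
    using 0 by (intro eq_matI) auto
  then show ?case using unitary_mat_one[of 0] by (intro exI[of _ "1\<^sub>m 0"] exI[of _ "\<lambda>_. 0"]) auto
next
  case (Suc n A)
  let ?n = "Suc n"
  from char_poly_factorized[OF Suc.prems(1)] obtain es where
    es: "char_poly A = (\<Prod>a\<leftarrow>es. [:- a, 1:])" "length es = ?n" by auto
  then obtain e es' where "es = e # es'" by (cases es) auto
  then have "eigenvalue A e"
    using es by (subst eigenvalue_root_char_poly[OF Suc.prems(1)]) auto
  then obtain v where v: "v \<in> carrier_vec ?n" "v \<noteq> 0\<^sub>v ?n" "A *\<^sub>v v = e \<cdot>\<^sub>v v"
    using Suc.prems by (auto simp: eigenvalue_def eigenvector_def)
  obtain W c where W: "unitary_mat ?n W" and Wv: "\<And>i. i < ?n \<Longrightarrow> W $$ (i, 0) = c * v $ i"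
    using unitary_extension[OF v(1,2)] by auto
  note W' = unitary_matD[OF W]
  define B where "B = mat_adjoint W * A * W"
  have B: "B \<in> carrier_mat ?n ?n" using W' Suc.prems by (auto simp: B_def)
  have A_eq: "A = W * B * mat_adjoint W"
    using unitary_conj_inverse[OF W Suc.prems(1)] by (simp add: B_def)
  have Bh: "mat_adjoint B = B"
    unfolding B_def
    using mat_adjoint_conj[OF W'(2) Suc.prems(1), unfolded mat_adjoint_adjoint Suc.prems(2)] .
  have AW: "(A * W) $$ (i, 0) = e * W $$ (i, 0)" if "i < ?n" for i
  proof -
    have "(A * W) $$ (i, 0) = (\<Sum>k<?n. A $$ (i, k) * W $$ (k, 0))"
      using that W' Suc.prems by (intro index_mult_mat_sum) auto
    also have "\<dots> = (\<Sum>k<?n. c * (A $$ (i, k) * v $ k))"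
      using Wv by (intro sum.cong) auto
    also have "\<dots> = c * (A *\<^sub>v v) $ i"
      using that Suc.prems v
      by (subst index_mult_mat_vec_sum[of _ ?n ?n]) (auto simp: sum_distrib_left simp del: sum.lessThan_Suc)
    finally have "(A * W) $$ (i, 0) = c * (A *\<^sub>v v) $ i" .
    then show ?thesis using v that Wv by simp
  qed
  \<comment> \<open>\<open>mat_adjoint W\<close> maps \<open>e\<close> times the first column of
    \<open>W\<close> to \<open>e\<close> times the first unit vector.\<close>
  have B0: "B $$ (i, 0) = (if i = 0 then e else 0)" if "i < ?n" for i
  proof -
    have "B $$ (i, 0) = (mat_adjoint W * (A * W)) $$ (i, 0)"
      unfolding B_def using W' Suc.prems by (subst assoc_mult_mat[of _ ?n ?n]) auto
    also have "\<dots> = (\<Sum>k<?n. mat_adjoint W $$ (i, k) * (e * W $$ (k, 0)))"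
      using W' Suc.prems that AW
      by (subst index_mult_mat_sum[of _ ?n ?n _ ?n])
        (auto intro!: sum.cong simp del: index_mult_mat(1) sum.lessThan_Suc)
    also have "\<dots> = e * (mat_adjoint W * W) $$ (i, 0)"
      using W'(1,2) that
      by (subst index_mult_mat_sum[of _ ?n ?n _ ?n])
        (auto simp: sum_distrib_left mult_ac simp del: sum.lessThan_Suc)
    finally show ?thesis using W'(3) that by simp
  qed
  have B0': "B $$ (0, i) = (if i = 0 then e else 0)" if "i < ?n" for i
    using B0[OF that] B0[of 0] arg_cong[OF Bh, of "\<lambda>M. M $$ (0, i)"] 
      arg_cong[OF Bh, of "\<lambda>M. M $$ (0, 0)"] B that by auto
  \<comment> \<open>The eigenvalue \<open>e\<close> is a diagonal entry of the Hermitian matrix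
    \<open>B\<close>, hence real.\<close>
  have e: "e = complex_of_real (Re e)"
    using B0[of 0] arg_cong[OF Bh, of "\<lambda>M. M $$ (0, 0)"] B
    by (simp add: complex_eq_iff)
  define C where "C = mat n n (\<lambda>(i, j). B $$ (Suc i, Suc j))"
  have C: "C \<in> carrier_mat n n" by (simp add: C_def)
  have "mat_adjoint C = C"
  proof (intro eq_matI)
    fix i j assume "i < dim_row C" "j < dim_col C"
    then have ij: "i < n" "j < n" by (auto simp: C_def)
    have "mat_adjoint B $$ (Suc i, Suc j) = B $$ (Suc i, Suc j)" using Bh by simp
    then show "mat_adjoint C $$ (i, j) = C $$ (i, j)" using ij B by (simp add: C_def)
  qed (use C in auto)
  from Suc.IH[OF C this] obtain V D where V: "unitary_mat n V"
    and CV: "C = V * diag_of n (\<lambda>i. complex_of_real (D i)) * mat_adjoint V" by auto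
  note V' = unitary_matD[OF V]
  \<comment> \<open>\<open>blk a M\<close> is the direct sum of the scalar \<open>a\<close> and
    \<open>M\<close>. It is compatible with products and adjoints, so a diagonalisation of
    \<open>C\<close> extends to one of \<open>B\<close>.\<close>
  define blk where "blk a M = four_block_mat (mat 1 1 (\<lambda>_. a)) (0\<^sub>m 1 n) (0\<^sub>m n 1) M"
    for a :: complex and M
  have blk_mult: "blk a M * blk b N = blk (a * b) (M * N)"
    if "M \<in> carrier_mat n n" "N \<in> carrier_mat n n" for a b M N
    unfolding blk_def using that
    by (subst mult_four_block_mat[of _ 1 1 _ n _ n _ _ 1 _ n])
      (auto intro!: arg_cong3[of _ _ _ _ _ _ "\<lambda>x. four_block_mat x (0\<^sub>m 1 n)"]
        simp: scalar_prod_def)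
  have blk_adj: "mat_adjoint (blk a M) = blk (cnj a) (mat_adjoint M)"
    if "M \<in> carrier_mat n n" for a M
    using that by (intro eq_matI) (auto simp: blk_def)
  have blk_c: "blk a M \<in> carrier_mat ?n ?n" if "M \<in> carrier_mat n n" for a M
    using that by (auto simp: blk_def)
  have BC: "B = blk e C"
  proof (intro eq_matI)
    fix i j assume "i < dim_row (blk e C)" "j < dim_col (blk e C)"
    then have ij: "i < ?n" "j < ?n" using blk_c[OF C, of e] by auto
    then show "B $$ (i, j) = blk e C $$ (i, j)"
      using B0[of i] B0'[of j] by (cases i; cases j) (auto simp: blk_def C_def)
  qed (use B blk_c[OF C, of e] in auto)
  define E where "E i = (case i of 0 \<Rightarrow> Re e | Suc j \<Rightarrow> D j)" for i
  have diag: "diag_of ?n (\<lambda>i. complex_of_real (E i)) = blk e (diag_of n (\<lambda>i. complex_of_real (D i)))"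
  proof (intro eq_matI)
    fix i j assume "i < dim_row (blk e (diag_of n (\<lambda>i. complex_of_real (D i))))"
      "j < dim_col (blk e (diag_of n (\<lambda>i. complex_of_real (D i))))"
    then have "i < ?n" "j < ?n" by (auto simp: blk_def)
    then show "diag_of ?n (\<lambda>i. complex_of_real (E i)) $$ (i, j)
        = blk e (diag_of n (\<lambda>i. complex_of_real (D i))) $$ (i, j)"
      using e by (cases i; cases j) (auto simp: blk_def E_def)
  qed (auto simp: blk_def)
  have "unitary_mat ?n (blk 1 V)"
  proof (rule unitary_matI)
    have "blk 1 (1\<^sub>m n) = 1\<^sub>m ?n"
      by (intro eq_matI) (auto simp: blk_def)
    then show "mat_adjoint (blk 1 V) * blk 1 V = 1\<^sub>m ?n"
      using V' by (simp add: blk_adj blk_mult)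
  qed (use blk_c V' in auto)
  then have U: "unitary_mat ?n (W * blk 1 V)" using W by (intro unitary_mat_mult)
  have "B = blk 1 V * diag_of ?n (\<lambda>i. complex_of_real (E i)) * mat_adjoint (blk 1 V)"
    using V' by (simp add: BC CV diag blk_adj blk_mult)
  then have "A = W * (blk 1 V * diag_of ?n (\<lambda>i. complex_of_real (E i)) * mat_adjoint (blk 1 V))
      * mat_adjoint W"
    using A_eq by simp
  also have "\<dots> = (W * blk 1 V) * diag_of ?n (\<lambda>i. complex_of_real (E i)) * mat_adjoint (W * blk 1 V)"
    using W' blk_c[OF V'(1), of 1]
    by (simp add: mat_adjoint_mult[of _ ?n ?n _ ?n] assoc_mult_mat[of _ ?n ?n _ ?n _ ?n])
  finally show ?case using U by blast
qed

section \<open>Square roots, trace norm and rank\<close>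

lemma index_conj_diag:
  assumes "U \<in> carrier_mat n n" "i < n" "j < n"
  shows "(U * diag_of n f * mat_adjoint U) $$ (i, j)
    = (\<Sum>k<n. f k * (U $$ (i, k) * cnj (U $$ (j, k))))"
proof -
  have "(U * diag_of n f * mat_adjoint U) $$ (i, j)
      = (\<Sum>k<n. (U * diag_of n f) $$ (i, k) * mat_adjoint U $$ (k, j))"
    using assms by (intro index_mult_mat_sum) auto
  also have "\<dots> = (\<Sum>k<n. f k * (U $$ (i, k) * cnj (U $$ (j, k))))"
    using assms by (intro sum.cong) (auto simp: index_mult_diag_of[of _ n n] simp del: index_mult_mat(1))
  finally show ?thesis .
qed

lemma cscalar_prod_mult_mat_vec:
  fixes A :: "complex mat"
  assumes "A \<in> carrier_mat n m" "x \<in> carrier_vec m" "y \<in> carrier_vec n"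
  shows "(A *\<^sub>v x) \<bullet>c y = x \<bullet>c (mat_adjoint A *\<^sub>v y)"
proof -
  have "(A *\<^sub>v x) \<bullet>c y = (\<Sum>i<n. \<Sum>k<m. A $$ (i, k) * x $ k * cnj (y $ i))"
    using assms
    by (subst cscalar_prod_eq_sum[of _ n])
      (auto simp: index_mult_mat_vec_sum[of _ n m] sum_distrib_right
        simp del: index_mult_mat_vec intro!: sum.cong)
  also have "\<dots> = (\<Sum>k<m. \<Sum>i<n. A $$ (i, k) * x $ k * cnj (y $ i))"
    by (rule sum.swap)
  also have "\<dots> = x \<bullet>c (mat_adjoint A *\<^sub>v y)"
    using assms mult_mat_vec_carrier[of "mat_adjoint A" m n y]
    by (subst cscalar_prod_eq_sum[of _ m])
      (auto simp: index_mult_mat_vec_sum[of _ m n] sum_distrib_left mult_ac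
        simp del: index_mult_mat_vec intro!: sum.cong)
  finally show ?thesis .
qed

lemma diag_of_mult_vec:
  assumes "v \<in> carrier_vec n"
  shows "diag_of n f *\<^sub>v v = vec n (\<lambda>i. f i * v $ i)"
proof (intro eq_vecI)
  fix i assume "i < dim_vec (vec n (\<lambda>i. f i * v $ i))"
  then have i: "i < n" by simp
  have "(diag_of n f *\<^sub>v v) $ i = (\<Sum>k<n. diag_of n f $$ (i, k) * v $ k)"
    using i assms by (intro index_mult_mat_vec_sum) auto
  also have "\<dots> = (\<Sum>k<n. if k = i then f i * v $ i else 0)"
    using i by (intro sum.cong) auto
  finally show "(diag_of n f *\<^sub>v v) $ i = vec n (\<lambda>i. f i * v $ i) $ i"
    using i by simp
qed auto

lemma of_real_nonneg_complex [simp]: "0 \<le> complex_of_real x \<longleftrightarrow> 0 \<le> x"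
  by (simp add: less_eq_complex_def)

lemma mat_adjoint_conj_diag_real:
  assumes "U \<in> carrier_mat n n"
  shows "mat_adjoint (U * diag_of n (\<lambda>i. complex_of_real (D i)) * mat_adjoint U)
    = U * diag_of n (\<lambda>i. complex_of_real (D i)) * mat_adjoint U"
  using mat_adjoint_conj[OF assms carrier_diag_of] by (simp add: mat_adjoint_diag_of)

text \<open>Moving \<open>U\<close> across the inner product leaves the form of a diagonal matrix,
  evaluated at the coordinates \<open>w\<close> of \<open>v\<close> in the eigenbasis.\<close>

lemma cscalar_prod_conj_diag:
  fixes D :: "nat \<Rightarrow> real"
  assumes U: "U \<in> carrier_mat n n" and v: "v \<in> carrier_vec n"
  defines "w \<equiv> mat_adjoint U *\<^sub>v v"
  shows "((U * diag_of n (\<lambda>i. complex_of_real (D i)) * mat_adjoint U) *\<^sub>v v) \<bullet>c v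
    = complex_of_real (\<Sum>i<n. D i * (cmod (w $ i))\<^sup>2)"
proof -
  let ?D = "diag_of n (\<lambda>i. complex_of_real (D i))"
  have w: "w \<in> carrier_vec n" using U v by (auto simp: w_def)
  have Dw: "?D *\<^sub>v w \<in> carrier_vec n" using w by (auto intro: mult_mat_vec_carrier)
  have "(U * ?D * mat_adjoint U) *\<^sub>v v = U *\<^sub>v (?D *\<^sub>v w)"
    using U v by (simp add: w_def assoc_mult_mat_vec[of _ n n _ n])
  then have "((U * ?D * mat_adjoint U) *\<^sub>v v) \<bullet>c v = (?D *\<^sub>v w) \<bullet>c w"
    using cscalar_prod_mult_mat_vec[OF U Dw v] by (simp add: w_def)
  also have "\<dots> = (\<Sum>i<n. D i * w $ i * cnj (w $ i))"
    using w Dw by (subst cscalar_prod_eq_sum[of _ n]) (auto simp: diag_of_mult_vec[OF w])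
  finally show ?thesis
    by (simp add: mult.assoc complex_norm_square del: of_real_power)
qed

lemma psd_mat_conj_diag:
  assumes U: "unitary_mat n U" and D: "\<And>i. i < n \<Longrightarrow> 0 \<le> D i"
  shows "psd_mat n (U * diag_of n (\<lambda>i. complex_of_real (D i)) * mat_adjoint U)"
  unfolding psd_mat_def
  using unitary_matD[OF U] D
  by (auto simp: mat_adjoint_conj_diag_real cscalar_prod_conj_diag
      simp del: of_real_sum of_real_mult of_real_power intro!: sum_nonneg)

lemma psd_spectral:
  assumes "psd_mat n A"
  obtains U D where "unitary_mat n U" "\<And>i. i < n \<Longrightarrow> 0 \<le> D i"
    "A = U * diag_of n (\<lambda>i. complex_of_real (D i)) * mat_adjoint U"
proof -
  have A: "A \<in> carrier_mat n n" "mat_adjoint A = A"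
    "\<And>v. v \<in> carrier_vec n \<Longrightarrow> 0 \<le> (A *\<^sub>v v) \<bullet>c v"
    using assms by (auto simp: psd_mat_def)
  obtain U D where U: "unitary_mat n U"
    and AU: "A = U * diag_of n (\<lambda>i. complex_of_real (D i)) * mat_adjoint U"
    using hermitian_spectral[OF A(1,2)] by auto
  note U' = unitary_matD[OF U]
  have "0 \<le> D i" if "i < n" for i
  proof -
    \<comment> \<open>\<open>v\<close> is the \<open>i\<close>-th column of \<open>U\<close>, so the
      quadratic form at \<open>v\<close> is exactly the eigenvalue \<open>D i\<close>.\<close>
    define v where "v = U *\<^sub>v unit_vec n i"
    have v: "v \<in> carrier_vec n" using U' by (auto simp: v_def intro: mult_mat_vec_carrier)
    have "mat_adjoint U *\<^sub>v v = unit_vec n i"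
      using U' by (simp add: v_def flip: assoc_mult_mat_vec[of _ n n _ n])
    then have "(A *\<^sub>v v) \<bullet>c v = complex_of_real (\<Sum>k<n. D k * (cmod (unit_vec n i $ k))\<^sup>2)"
      unfolding AU using cscalar_prod_conj_diag[OF U'(1) v] by simp
    also have "(\<Sum>k<n. D k * (cmod (unit_vec n i $ k))\<^sup>2) = (\<Sum>k<n. if k = i then D i else 0)"
      using that by (intro sum.cong) auto
    finally show ?thesis using A(3)[OF v] that by simp
  qed
  then show thesis using that[OF U _ AU] by auto
qed

text \<open>\<open>psd_sqrt\<close> is a definite description, so computing it requires uniqueness
  of the positive semidefinite root. Squares of Hermitian matrices are what
  \<open>trace_norm\<close> leads to; \<open>D\<close> may have either sign, whence the absolute
  values.\<close>

lemma psd_sqrt_square: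
  fixes D :: "nat \<Rightarrow> real"
  assumes V: "unitary_mat n V"
  defines "\<Delta> \<equiv> V * diag_of n (\<lambda>i. complex_of_real (D i)) * mat_adjoint V"
  shows "psd_sqrt (\<Delta> * \<Delta>) = V * diag_of n (\<lambda>i. complex_of_real \<bar>D i\<bar>) * mat_adjoint V"
proof -
  note V' = unitary_matD[OF V]
  let ?R = "V * diag_of n (\<lambda>i. complex_of_real \<bar>D i\<bar>) * mat_adjoint V"
  have R: "psd_mat n ?R" by (intro psd_mat_conj_diag V) auto
  have \<Delta>2: "\<Delta> * \<Delta> = V * diag_of n (\<lambda>i. complex_of_real ((D i)\<^sup>2)) * mat_adjoint V"
    unfolding \<Delta>_def
    by (subst unitary_conj_mult[OF V]) (auto simp: diag_of_mult power2_eq_square)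
  have R2: "?R * ?R = \<Delta> * \<Delta>"
    unfolding \<Delta>2
    by (subst unitary_conj_mult[OF V])
      (auto simp: diag_of_mult power2_eq_square simp flip: of_real_mult)
  have uniq: "S = ?R" if S: "psd_mat n S" and S2: "S * S = \<Delta> * \<Delta>" for S
  proof -
    obtain W E where W: "unitary_mat n W" and E: "\<And>i. i < n \<Longrightarrow> 0 \<le> E i"
      and SW: "S = W * diag_of n (\<lambda>i. complex_of_real (E i)) * mat_adjoint W"
      using psd_spectral[OF S] by metis
    note W' = unitary_matD[OF W]
    \<comment> \<open>\<open>T\<close> intertwines the two diagonalisations of the square, hence also their square roots.\<close>
    define T where "T = mat_adjoint V * W"
    have T: "T \<in> carrier_mat n n" using V' W' by (auto simp: T_def)
    have S2': "S * S = W * diag_of n (\<lambda>i. complex_of_real ((E i)\<^sup>2)) * mat_adjoint W"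
      unfolding SW
      by (subst unitary_conj_mult[OF W]) (auto simp: diag_of_mult power2_eq_square)
    have "diag_of n (\<lambda>i. complex_of_real ((D i)\<^sup>2)) * T = mat_adjoint V * (\<Delta> * \<Delta>) * W"
      unfolding \<Delta>2 T_def using V'(1,2) W'(1,2)
      by (simp add: assoc_mult_mat[of _ n n _ n _ n] unitary_mat_cancel[OF V, of _ n])
    also have "\<dots> = T * diag_of n (\<lambda>i. complex_of_real ((E i)\<^sup>2))"
      unfolding S2[symmetric] S2' T_def using V'(1,2) W'
      by (simp add: assoc_mult_mat[of _ n n _ n _ n])
    finally have eq: "diag_of n (\<lambda>i. complex_of_real ((D i)\<^sup>2)) * T
      = T * diag_of n (\<lambda>i. complex_of_real ((E i)\<^sup>2))" .
    have "diag_of n (\<lambda>i. complex_of_real \<bar>D i\<bar>) * T = T * diag_of n (\<lambda>i. complex_of_real (E i))"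
    proof (intro eq_matI)
      fix i j assume "i < dim_row (T * diag_of n (\<lambda>i. complex_of_real (E i)))"
        "j < dim_col (T * diag_of n (\<lambda>i. complex_of_real (E i)))"
      then have ij: "i < n" "j < n" using T by auto
      have "complex_of_real ((D i)\<^sup>2) * T $$ (i, j) = T $$ (i, j) * complex_of_real ((E j)\<^sup>2)"
        using arg_cong[OF eq, of "\<lambda>M. M $$ (i, j)"] ij T
        by (simp add: index_mult_diag_of[of _ n n] index_diag_of_mult[of _ n n] del: index_mult_mat(1))
      \<comment> \<open>Where an entry of \<open>T\<close> is nonzero the squared eigenvalues agree,
        and nonnegativity of \<open>E\<close> then fixes the sign of the root.\<close>
      then have "T $$ (i, j) = 0 \<or> complex_of_real ((D i)\<^sup>2) = complex_of_real ((E j)\<^sup>2)"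
        by (simp add: mult.commute del: of_real_power)
      then have "T $$ (i, j) = 0 \<or> (D i)\<^sup>2 = (E j)\<^sup>2"
        by (simp only: of_real_eq_iff)
      then have "T $$ (i, j) = 0 \<or> \<bar>D i\<bar> = E j"
        using E[OF ij(2)] by (auto simp: power2_eq_iff)
      then show "(diag_of n (\<lambda>i. complex_of_real \<bar>D i\<bar>) * T) $$ (i, j)
          = (T * diag_of n (\<lambda>i. complex_of_real (E i))) $$ (i, j)"
        using ij T by (auto simp: index_mult_diag_of[of _ n n] index_diag_of_mult[of _ n n]
            simp del: index_mult_mat(1))
    qed (use T in auto)
    moreover have "S = V * (T * diag_of n (\<lambda>i. complex_of_real (E i))) * mat_adjoint W"
      unfolding SW T_def using V'(1,2) W'(1,2)
      by (simp add: assoc_mult_mat[of _ n n _ n _ n] unitary_mat_cancel[OF V, of _ n])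
    moreover have "V * (diag_of n (\<lambda>i. complex_of_real \<bar>D i\<bar>) * T) * mat_adjoint W = ?R"
      unfolding T_def using V'(1,2) W'
      by (simp add: assoc_mult_mat[of _ n n _ n _ n])
    ultimately show ?thesis by simp
  qed
  have dim: "dim_row (\<Delta> * \<Delta>) = n" using V' by (simp add: \<Delta>_def)
  show ?thesis
    unfolding psd_sqrt_def dim
  proof (rule the_equality)
    show "psd_mat n ?R \<and> ?R * ?R = \<Delta> * \<Delta>" using R R2 by blast
  qed (use uniq in blast)
qed

section \<open>Trace and trace norm\<close>

lemma mat_trace_conj_diag:
  assumes U: "unitary_mat n U"
  shows "mat_trace (U * diag_of n f * mat_adjoint U) = (\<Sum>i<n. f i)"
proof -
  note U' = unitary_matD[OF U]
  have "mat_trace (U * diag_of n f * mat_adjoint U)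
      = (\<Sum>i<n. \<Sum>k<n. f k * (U $$ (i, k) * cnj (U $$ (i, k))))"
    using U' by (auto simp: mat_trace_def index_conj_diag simp del: index_mult_mat(1) intro!: sum.cong)
  also have "\<dots> = (\<Sum>k<n. \<Sum>i<n. f k * (U $$ (i, k) * cnj (U $$ (i, k))))"
    by (rule sum.swap)
  also have "\<dots> = (\<Sum>k<n. f k * (\<Sum>i<n. cnj (U $$ (i, k)) * U $$ (i, k)))"
    by (simp add: sum_distrib_left mult_ac)
  finally show ?thesis using unitary_mat_cols[OF U] by simp
qed

text \<open>One direction of trace-norm duality, tested against a diagonal contraction; it is the
  only fact about \<open>trace_norm\<close> that the main argument uses. Each eigenvalue
  \<open>D k\<close> enters with a weighted sum of the squared moduli in column \<open>k\<close> of
  \<open>U\<close>, and this coefficient lies between -1 and 1 because the columns are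
  normalised.\<close>

lemma trace_norm_ge_weighted_diag:
  assumes A: "A \<in> carrier_mat n n" "mat_adjoint A = A"
    and w: "\<And>i. i < n \<Longrightarrow> \<bar>w i\<bar> \<le> 1"
  shows "(\<Sum>i<n. w i * Re (A $$ (i, i))) \<le> trace_norm A"
proof -
  obtain U D where U: "unitary_mat n U"
    and AU: "A = U * diag_of n (\<lambda>i. complex_of_real (D i)) * mat_adjoint U"
    using hermitian_spectral[OF A] by auto
  note U' = unitary_matD[OF U]
  have cols: "(\<Sum>i<n. (cmod (U $$ (i, k)))\<^sup>2) = 1" if "k < n" for k
  proof -
    have "complex_of_real (\<Sum>i<n. (cmod (U $$ (i, k)))\<^sup>2) = 1"
      using unitary_mat_cols[OF U that that]
      by (simp add: complex_norm_square mult.commute del: of_real_power)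
    then show ?thesis by (simp only: of_real_eq_1_iff)
  qed
  have diag: "Re (A $$ (i, i)) = (\<Sum>k<n. D k * (cmod (U $$ (i, k)))\<^sup>2)" if "i < n" for i
  proof -
    have "A $$ (i, i) = complex_of_real (\<Sum>k<n. D k * (cmod (U $$ (i, k)))\<^sup>2)"
      unfolding AU using index_conj_diag[OF U'(1) that that]
      by (simp add: complex_norm_square del: of_real_power)
    then show ?thesis by simp
  qed
  have "(\<Sum>i<n. w i * Re (A $$ (i, i))) = (\<Sum>i<n. \<Sum>k<n. D k * (w i * (cmod (U $$ (i, k)))\<^sup>2))"
    by (auto simp: diag sum_distrib_left mult_ac intro!: sum.cong)
  also have "\<dots> = (\<Sum>k<n. D k * (\<Sum>i<n. w i * (cmod (U $$ (i, k)))\<^sup>2))"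
    by (subst sum.swap) (simp add: sum_distrib_left)
  also have "\<dots> \<le> (\<Sum>k<n. \<bar>D k\<bar>)"
  proof (rule sum_mono)
    fix k assume "k \<in> {..<n}"
    then have k: "k < n" by simp
    have "\<bar>\<Sum>i<n. w i * (cmod (U $$ (i, k)))\<^sup>2\<bar> \<le> (\<Sum>i<n. \<bar>w i * (cmod (U $$ (i, k)))\<^sup>2\<bar>)"
      by (rule sum_abs)
    also have "\<dots> \<le> (\<Sum>i<n. (cmod (U $$ (i, k)))\<^sup>2)"
      using w by (intro sum_mono) (auto simp: abs_mult mult_left_le_one_le)
    finally have "\<bar>\<Sum>i<n. w i * (cmod (U $$ (i, k)))\<^sup>2\<bar> \<le> 1" using cols[OF k] by simp
    then have "\<bar>D k * (\<Sum>i<n. w i * (cmod (U $$ (i, k)))\<^sup>2)\<bar> \<le> \<bar>D k\<bar>"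
      by (simp add: abs_mult mult_left_le)
    then show "D k * (\<Sum>i<n. w i * (cmod (U $$ (i, k)))\<^sup>2) \<le> \<bar>D k\<bar>" by linarith
  qed
  also have "\<dots> = trace_norm A"
    unfolding trace_norm_def A(2) unfolding AU
    by (simp add: psd_sqrt_square[OF U] mat_trace_conj_diag[OF U])
  finally show ?thesis .
qed

section \<open>Eigenvalues and rank read off from a diagonalisation\<close>

lemma eigenvalue_conj_diag:
  assumes U: "unitary_mat n U"
  shows "eigenvalue (U * diag_of n f * mat_adjoint U) z \<longleftrightarrow> (\<exists>i<n. f i = z)"
proof -
  note U' = unitary_matD[OF U]
  let ?A = "U * diag_of n f * mat_adjoint U"
  have A: "?A \<in> carrier_mat n n" using U' by auto
  have "similar_mat ?A (diag_of n f)"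
    using U' by (intro similar_matI[of _ _ U "mat_adjoint U" n]) auto
  then have "char_poly ?A = char_poly (diag_of n f)" by (rule char_poly_similar)
  also have "\<dots> = (\<Prod>a\<leftarrow>diag_mat (diag_of n f). [:- a, 1:])"
    by (intro char_poly_upper_triangular[of _ n]) (auto simp: upper_triangular_def)
  finally have "eigenvalue ?A z \<longleftrightarrow> (\<exists>a \<in> set (diag_mat (diag_of n f)). z = a)"
    using A by (auto simp: eigenvalue_root_char_poly[OF A] poly_prod_list prod_list_zero_iff)
  also have "set (diag_mat (diag_of n f)) = f ` {..<n}"
    by (auto simp: diag_mat_def)
  finally show ?thesis by auto
qed

text \<open>An invertible right factor leaves the column space unchanged, and the rank is its
  dimension.\<close>

lemma rank_mult_invertible:
  fixes A P P' :: "complex mat"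
  assumes A: "A \<in> carrier_mat n n" and P: "P \<in> carrier_mat n n" "P' \<in> carrier_mat n n"
    and PP: "P * P' = 1\<^sub>m n"
  shows "vec_space.rank n (A * P) = vec_space.rank n A"
proof -
  interpret vec_space "TYPE(complex)" n .
  have "col_space (A * P) = col_space A"
  proof (intro equalityI subsetI)
    fix y assume "y \<in> col_space (A * P)"
    then obtain x where "x \<in> carrier_vec n" "(A * P) *\<^sub>v x = y" "y \<in> carrier_vec n"
      using A P by (subst (asm) col_space_eq[of _ n]) auto
    then show "y \<in> col_space A"
      using A P by (subst col_space_eq[of _ n])
        (auto intro!: bexI[of _ "P *\<^sub>v x"] mult_mat_vec_carrier simp flip: assoc_mult_mat_vec)
  next
    fix y assume "y \<in> col_space A"
    then obtain x where x: "x \<in> carrier_vec n" "A *\<^sub>v x = y" "y \<in> carrier_vec n"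
      using A P by (subst (asm) col_space_eq[of _ n]) auto
    have "(A * P) *\<^sub>v (P' *\<^sub>v x) = A *\<^sub>v ((P * P') *\<^sub>v x)"
      using A P x by (simp add: assoc_mult_mat_vec[of _ n n _ n] mult_mat_vec_carrier del: PP)
    then have "(A * P) *\<^sub>v (P' *\<^sub>v x) = y"
      using PP x by simp
    then show "y \<in> col_space (A * P)"
      using A P x by (subst col_space_eq[of _ n])
        (auto intro!: bexI[of _ "P' *\<^sub>v x"] mult_mat_vec_carrier)
  qed
  then show ?thesis by (simp add: rank_def col_space_def)
qed

text \<open>The right factor is invertible and drops out. The columns of
  \<open>U * diag_of n f\<close> are multiples of the columns of \<open>U\<close>, and the nonzero
  ones among them form a maximal independent set.\<close>

lemma rank_conj_diag:
  assumes U: "unitary_mat n U"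
  shows "vec_space.rank n (U * diag_of n f * mat_adjoint U) = card {i. i < n \<and> f i \<noteq> 0}"
proof -
  interpret vec_space "TYPE(complex)" n .
  note U' = unitary_matD[OF U]
  let ?I = "{i. i < n \<and> f i \<noteq> 0}"
  define A where "A = U * diag_of n f"
  have A: "A \<in> carrier_mat n n" using U' by (auto simp: A_def)
  \<comment> \<open>Replacing the zeros of \<open>f\<close> by 1 makes \<open>B\<close> invertible
    without changing the columns at which \<open>f\<close> is nonzero, so their independence is
    inherited from \<open>B\<close>.\<close>
  define g where "g i = (if f i = 0 then 1 else f i)" for i
  define B where "B = U * diag_of n g"
  have B: "B \<in> carrier_mat n n" using U' by (auto simp: B_def)
  have "det U * det (mat_adjoint U) = 1"
    using U' by (simp flip: det_mult[of _ n])
  moreover have "det (diag_of n g) = (\<Prod>a\<leftarrow>diag_mat (diag_of n g). a)"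
    by (subst det_upper_triangular[of _ n]) (auto simp: upper_triangular_def)
  ultimately have "det B \<noteq> 0"
    unfolding B_def using U'
    by (auto simp: det_mult[of _ n] diag_mat_def prod_list_zero_iff g_def)
  then have rB: "rank B = n" by (rule low_rank_det_zero[OF B])
  then have dB: "distinct (cols B)" using non_distinct_low_rank[OF B] by auto
  then have iB: "lin_indpt (set (cols B))" using full_rank_lin_indpt[OF B rB] by simp
  have colA: "col A i = (if f i = 0 then 0\<^sub>v n else col B i)" if "i < n" for i
    using U' that A B
    by (intro eq_vecI) (auto simp: A_def B_def g_def index_mult_diag_of[of _ n n] simp del: index_mult_mat(1))
  define C where "C = col B ` ?I"
  have CB: "C \<subseteq> set (cols B)" using B by (auto simp: C_def cols_def)
  have iC: "lin_indpt C" using subset_li_is_li[OF iB CB] .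
  have CA: "C \<subseteq> set (cols A)"
  proof
    fix x assume "x \<in> C"
    then obtain i where "i < n" "f i \<noteq> 0" "x = col B i" by (auto simp: C_def)
    then have "x = col A i" "i < dim_col A" using colA[of i] A by auto
    then show "x \<in> set (cols A)" by (auto simp: cols_def)
  qed
  have AC: "set (cols A) \<subseteq> insert (0\<^sub>v n) C"
  proof
    fix x assume "x \<in> set (cols A)"
    then obtain i where i: "i < n" "x = col A i" using A by (auto simp: cols_def)
    then show "x \<in> insert (0\<^sub>v n) C"
      using colA[OF i(1)] by (cases "f i = 0") (auto simp: C_def)
  qed
  \<comment> \<open>Any column of \<open>A\<close> outside \<open>C\<close> is the zero vector,
    which no independent set contains.\<close>
  have "maximal C (\<lambda>T. T \<subseteq> set (cols A) \<and> lin_indpt T)"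
    unfolding maximal_def
  proof (intro conjI allI impI CA iC)
    fix T assume T: "C \<subseteq> T \<and> T \<subseteq> set (cols A) \<and> lin_indpt T"
    have "T \<subseteq> carrier_vec n" using T cols_dim[of A] A by auto
    moreover have "(UNIV :: complex set) \<noteq> {0}" using one_neq_zero by blast
    ultimately have "0\<^sub>v n \<notin> T" using T zero_nin_lin_indpt[of T] by auto
    then show "T = C" using T AC by auto
  qed
  then have "rank A = card C" by (rule rank_card_indpt[OF A])
  also have "inj_on (col B) ?I"
    using dB B by (intro inj_onI) (auto simp: distinct_conv_nth)
  then have "card C = card ?I" unfolding C_def by (rule card_image)
  finally show ?thesis
    using rank_mult_invertible[OF A, of "mat_adjoint U" U] U' by (simp add: A_def)
qed

section \<open>Tensor products and the evolution of the state vector\<close>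

lemma sum_div_mod:
  fixes f :: "nat \<Rightarrow> nat \<Rightarrow> 'a :: comm_monoid_add"
  shows "(\<Sum>k<m * n. f (k div n) (k mod n)) = (\<Sum>p<m. \<Sum>q<n. f p q)"
proof -
  have "(\<Sum>p<m. \<Sum>k\<in>{p * n..<p * n + n}. f (k div n) (k mod n)) = (\<Sum>p<m. \<Sum>q<n. f p q)"
  proof (rule sum.cong)
    fix p
    have "(\<Sum>k\<in>{p * n..<p * n + n}. f (k div n) (k mod n))
        = (\<Sum>q = 0..<n. f ((q + p * n) div n) ((q + p * n) mod n))"
      using sum.shift_bounds_nat_ivl[of "\<lambda>k. f (k div n) (k mod n)" 0 "p * n" n]
      by (simp add: add.commute)
    then show "(\<Sum>k\<in>{p * n..<p * n + n}. f (k div n) (k mod n)) = (\<Sum>q<n. f p q)"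
      by (simp add: atLeast0LessThan)
  qed simp
  then show ?thesis by (simp add: sum.nat_group)
qed

lemma div_less_of_less_mult: "(i :: nat) < m * n \<Longrightarrow> i div n < m"
  by (simp add: less_mult_imp_div_less)

lemma mod_less_of_less_mult: "(i :: nat) < m * n \<Longrightarrow> i mod n < n"
  by (cases "n = 0") auto

lemma dim_kron [simp]:
  "dim_row (kron A B) = dim_row A * dim_row B" "dim_col (kron A B) = dim_col A * dim_col B"
  by (simp_all add: kron_def)

lemma carrier_kron [simp]:
  "A \<in> carrier_mat m n \<Longrightarrow> B \<in> carrier_mat p q \<Longrightarrow> kron A B \<in> carrier_mat (m * p) (n * q)"
  by (auto intro!: carrier_matI)

lemma index_kron:
  "A \<in> carrier_mat m n \<Longrightarrow> B \<in> carrier_mat p q \<Longrightarrow> i < m * p \<Longrightarrow> j < n * q \<Longrightarrow>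
    kron A B $$ (i, j) = A $$ (i div p, j div q) * B $$ (i mod p, j mod q)"
  by (auto simp: kron_def)

text \<open>The mixed-product rule: the sum over a tensor index splits into two independent sums by
  \<open>sum_div_mod\<close>.\<close>

lemma kron_mult:
  assumes A: "A \<in> carrier_mat m n" and B: "B \<in> carrier_mat p q"
    and C: "C \<in> carrier_mat n l" and D: "D \<in> carrier_mat q r"
  shows "kron A B * kron C D = kron (A * C) (B * D)"
proof (intro eq_matI)
  fix i j assume "i < dim_row (kron (A * C) (B * D))" "j < dim_col (kron (A * C) (B * D))"
  then have ij: "i < m * p" "j < l * r" using A B C D by auto
  note ij' = ij[THEN div_less_of_less_mult] ij[THEN mod_less_of_less_mult]
  have AC: "A * C \<in> carrier_mat m l" and BD: "B * D \<in> carrier_mat p r"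
    using A B C D by (auto intro: mult_carrier_mat)
  have "(kron A B * kron C D) $$ (i, j) = (\<Sum>k<n * q. kron A B $$ (i, k) * kron C D $$ (k, j))"
    using ij A B C D by (intro index_mult_mat_sum[of _ "m * p"]) auto
  also have "\<dots> = (\<Sum>k<n * q. (A $$ (i div p, k div q) * C $$ (k div q, j div r)) *
      (B $$ (i mod p, k mod q) * D $$ (k mod q, j mod r)))"
    using ij by (intro sum.cong) (auto simp: index_kron[OF A B] index_kron[OF C D])
  also have "\<dots> = (\<Sum>x<n. A $$ (i div p, x) * C $$ (x, j div r)) *
      (\<Sum>y<q. B $$ (i mod p, y) * D $$ (y, j mod r))"
    by (subst sum_div_mod[of "\<lambda>x y. (A $$ (i div p, x) * C $$ (x, j div r)) *
      (B $$ (i mod p, y) * D $$ (y, j mod r))"]) (simp add: sum_product)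
  also have "\<dots> = kron (A * C) (B * D) $$ (i, j)"
    using ij ij' A B C D
    by (simp add: index_kron[OF AC BD] index_mult_mat_sum[of _ m n _ l] index_mult_mat_sum[of _ p q _ r]
        del: index_mult_mat(1))
  finally show "(kron A B * kron C D) $$ (i, j) = kron (A * C) (B * D) $$ (i, j)" .
qed auto

lemma mat_adjoint_kron: "mat_adjoint (kron A B) = kron (mat_adjoint A) (mat_adjoint B)"
  by (intro eq_matI)
    (auto simp: kron_def div_less_of_less_mult mod_less_of_less_mult)

lemma kron_one_diag: "kron (1\<^sub>m m) (diag_of n f) = diag_of (m * n) (\<lambda>i. f (i mod n))"
proof (intro eq_matI)
  fix i j assume "i < dim_row (diag_of (m * n) (\<lambda>i. f (i mod n)))"
    "j < dim_col (diag_of (m * n) (\<lambda>i. f (i mod n)))"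
  then have ij: "i < m * n" "j < m * n" by auto
  have "i = j" if "i div n = j div n" "i mod n = j mod n"
    using that by (metis div_mult_mod_eq)
  then show "kron (1\<^sub>m m) (diag_of n f) $$ (i, j) = diag_of (m * n) (\<lambda>i. f (i mod n)) $$ (i, j)"
    using ij ij[THEN div_less_of_less_mult] ij[THEN mod_less_of_less_mult]
    by (auto simp: index_kron[of _ m m _ n n])
qed auto

lemma kron_one_one: "kron (1\<^sub>m m) (1\<^sub>m n) = 1\<^sub>m (m * n)"
  using kron_one_diag[of m n "\<lambda>_. 1"] by (simp add: diag_of_one)

lemma unitary_mat_kron_one:
  assumes "unitary_mat n U"
  shows "unitary_mat (m * n) (kron (1\<^sub>m m) U)"
proof -
  note U = unitary_matD[OF assms]
  have "mat_adjoint (kron (1\<^sub>m m) U) * kron (1\<^sub>m m) U = 1\<^sub>m (m * n)"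
    using U by (simp add: mat_adjoint_kron kron_mult[of _ m m _ n n _ m _ n] kron_one_one)
  then show ?thesis using U by (intro unitary_matI) auto
qed

lemma kron_minus:
  assumes "A \<in> carrier_mat m n" "B \<in> carrier_mat p q" "C \<in> carrier_mat p q"
  shows "kron A B - kron A C = kron A (B - C)"
  using assms
  by (intro eq_matI)
    (auto simp: kron_def div_less_of_less_mult mod_less_of_less_mult right_diff_distrib)

section \<open>Norms of the components of a vector on sets of coordinates\<close>

definition l2 :: "nat set \<Rightarrow> complex vec \<Rightarrow> real" where
  "l2 S v = L2_set (\<lambda>i. cmod (v $ i)) S"

lemma l2_nonneg [simp]: "0 \<le> l2 S v"
  by (simp add: l2_def)

lemma l2_square: "(l2 S v)\<^sup>2 = (\<Sum>i\<in>S. (cmod (v $ i))\<^sup>2)"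
  by (simp add: l2_def L2_set_def sum_nonneg)

lemma l2_mono:
  assumes "finite T" "S \<subseteq> T"
  shows "l2 S v \<le> l2 T v"
  unfolding l2_def L2_set_def using assms by (intro real_sqrt_le_mono sum_mono2) auto

lemma l2_add:
  assumes "S \<subseteq> {..<n}" "u \<in> carrier_vec n" "v \<in> carrier_vec n"
  shows "l2 S (u + v) \<le> l2 S u + l2 S v"
proof -
  have "l2 S (u + v) \<le> L2_set (\<lambda>i. cmod (u $ i) + cmod (v $ i)) S"
    unfolding l2_def using assms
    by (intro L2_set_mono) (auto simp: subset_eq intro: norm_triangle_ineq)
  also have "\<dots> \<le> l2 S u + l2 S v" unfolding l2_def by (rule L2_set_triangle_ineq)
  finally show ?thesis .
qed

lemma l2_le_add_minus:
  assumes "S \<subseteq> {..<n}" "u \<in> carrier_vec n" "v \<in> carrier_vec n"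
  shows "l2 S u \<le> l2 S v + l2 S (u - v)"
proof -
  have "u = v + (u - v)" using assms by (intro eq_vecI) auto
  then show ?thesis using l2_add[OF assms(1), of v "u - v"] assms by auto
qed

text \<open>Moving \<open>K\<close> across the inner product produces
  \<open>mat_adjoint K * K\<close>. With \<open>w\<close> constantly 1 this is norm preservation by
  unitaries; with other weights it measures the difference of two oracles.\<close>

lemma sum_norm_mult_mat_vec:
  assumes K: "K \<in> carrier_mat n n" "mat_adjoint K * K = diag_of n (\<lambda>i. complex_of_real (w i))"
    and v: "v \<in> carrier_vec n"
  shows "(\<Sum>i<n. (cmod ((K *\<^sub>v v) $ i))\<^sup>2) = (\<Sum>i<n. w i * (cmod (v $ i))\<^sup>2)"
proof -
  have Kv: "K *\<^sub>v v \<in> carrier_vec n" using K v by simp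
  have "complex_of_real (\<Sum>i<n. (cmod ((K *\<^sub>v v) $ i))\<^sup>2) = (K *\<^sub>v v) \<bullet>c (K *\<^sub>v v)"
    by (rule cscalar_prod_self[OF Kv, symmetric])
  also have "\<dots> = v \<bullet>c (mat_adjoint K *\<^sub>v (K *\<^sub>v v))"
    by (rule cscalar_prod_mult_mat_vec[OF K(1) v Kv])
  also have "mat_adjoint K *\<^sub>v (K *\<^sub>v v) = diag_of n (\<lambda>i. complex_of_real (w i)) *\<^sub>v v"
    using K v by (simp flip: assoc_mult_mat_vec[of _ n n _ n])
  also have "v \<bullet>c \<dots> = complex_of_real (\<Sum>i<n. w i * (cmod (v $ i))\<^sup>2)"
    unfolding diag_of_mult_vec[OF v] using v
    by (subst cscalar_prod_eq_sum[of _ n])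
      (auto simp: complex_norm_square mult_ac simp del: of_real_power intro!: sum.cong)
  finally show ?thesis by (simp only: of_real_eq_iff)
qed

lemma l2_unitary:
  assumes U: "unitary_mat n U" and v: "v \<in> carrier_vec n"
  shows "l2 {..<n} (U *\<^sub>v v) = l2 {..<n} v"
  using sum_norm_mult_mat_vec[of U n "\<lambda>_. 1" v] unitary_matD[OF U] v
  by (simp add: l2_def L2_set_def diag_of_one)

section \<open>Pure states and their tensor products\<close>

lemma ket_carrier [simp]: "v \<in> carrier_vec n \<Longrightarrow> ket v \<in> carrier_mat n (Suc 0)"
  and bra_carrier [simp]: "v \<in> carrier_vec n \<Longrightarrow> bra v \<in> carrier_mat (Suc 0) n"
  and index_ket: "v \<in> carrier_vec n \<Longrightarrow> i < n \<Longrightarrow> ket v $$ (i, 0) = v $ i"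
  and index_bra: "v \<in> carrier_vec n \<Longrightarrow> i < n \<Longrightarrow> bra v $$ (0, i) = cnj (v $ i)"
  by (auto simp: ket_def bra_def mat_of_cols_index intro!: carrier_matI)

lemma carrier_pure_state [simp]: "v \<in> carrier_vec n \<Longrightarrow> pure_state v \<in> carrier_mat n n"
  unfolding pure_state_def by (rule mult_carrier_mat[of _ n "Suc 0"]) auto

lemma index_pure_state:
  assumes "v \<in> carrier_vec n" "i < n" "j < n"
  shows "pure_state v $$ (i, j) = v $ i * cnj (v $ j)"
  unfolding pure_state_def using assms
  by (subst index_mult_mat_sum[of _ n "Suc 0" _ n]) (auto simp: index_ket index_bra)

lemma ket_mult_mat_vec:
  assumes "A \<in> carrier_mat n m" "v \<in> carrier_vec m"
  shows "ket (A *\<^sub>v v) = A * ket v"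
proof -
  have Av: "A *\<^sub>v v \<in> carrier_vec n" using assms by (rule mult_mat_vec_carrier)
  show ?thesis
  proof (intro eq_matI)
    fix i j assume "i < dim_row (A * ket v)" "j < dim_col (A * ket v)"
    then have "i < n" "j = 0" using assms ket_carrier[OF assms(2)] by auto
    then show "ket (A *\<^sub>v v) $$ (i, j) = (A * ket v) $$ (i, j)"
      using assms ket_carrier[OF assms(2)] index_ket[OF Av]
      by (simp add: index_mult_mat_sum[of _ n m _ "Suc 0"] index_mult_mat_vec_sum[of _ n m] index_ket
          del: index_mult_mat(1) index_mult_mat_vec)
  qed (use assms carrier_matD[OF ket_carrier[OF assms(2)]] carrier_matD[OF ket_carrier[OF Av]] in auto)
qed

text \<open>This allows the evolution of density matrices to be followed on state vectors, where
  norms are available.\<close>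

lemma unitary_channel_pure_state:
  assumes "U \<in> carrier_mat n n" "v \<in> carrier_vec n"
  shows "unitary_channel U (pure_state v) = pure_state (U *\<^sub>v v)"
proof -
  note k = ket_carrier[OF assms(2)] and b = bra_carrier[OF assms(2)]
  have "U * (ket v * bra v) * mat_adjoint U = U * ket v * bra v * mat_adjoint U"
    using assoc_mult_mat[OF assms(1) k b] by simp
  also have "\<dots> = U * ket v * (bra v * mat_adjoint U)"
    using assms by (intro assoc_mult_mat[OF mult_carrier_mat[OF assms(1) k] b, of _ n]) simp
  also have "bra v * mat_adjoint U = mat_adjoint (U * ket v)"
    unfolding bra_def by (rule mat_adjoint_mult[OF assms(1) k, symmetric])
  finally show ?thesis
    by (simp add: unitary_channel_def pure_state_def bra_def ket_mult_mat_vec[OF assms])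
qed

definition kron_vec :: "complex vec \<Rightarrow> complex vec \<Rightarrow> complex vec" where
  "kron_vec u v = vec (dim_vec u * dim_vec v) (\<lambda>i. u $ (i div dim_vec v) * v $ (i mod dim_vec v))"

lemma carrier_kron_vec [simp]:
  "u \<in> carrier_vec m \<Longrightarrow> v \<in> carrier_vec n \<Longrightarrow> kron_vec u v \<in> carrier_vec (m * n)"
  by (intro carrier_vecI) (simp add: kron_vec_def)

lemma pure_state_kron_vec:
  assumes u: "u \<in> carrier_vec m" and v: "v \<in> carrier_vec n"
  shows "kron (pure_state u) (pure_state v) = pure_state (kron_vec u v)"
proof (intro eq_matI)
  fix i j assume "i < dim_row (pure_state (kron_vec u v))" "j < dim_col (pure_state (kron_vec u v))"
  then have ij: "i < m * n" "j < m * n" using carrier_pure_state[OF carrier_kron_vec[OF u v]] by auto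
  then show "kron (pure_state u) (pure_state v) $$ (i, j) = pure_state (kron_vec u v) $$ (i, j)"
    using u v ij[THEN div_less_of_less_mult] ij[THEN mod_less_of_less_mult]
    by (auto simp: index_kron[of _ m m _ n n] index_pure_state[of _ m] index_pure_state[of _ n]
        index_pure_state[of _ "m * n"] kron_vec_def)
qed (use carrier_pure_state[OF u] carrier_pure_state[OF v]
  carrier_pure_state[OF carrier_kron_vec[OF u v]] in auto)

lemma l2_kron_vec:
  assumes u: "u \<in> carrier_vec m" and v: "v \<in> carrier_vec n"
  shows "l2 {..<m * n} (kron_vec u v) = l2 {..<m} u * l2 {..<n} v"
proof -
  have "(\<Sum>i<m * n. (cmod (kron_vec u v $ i))\<^sup>2)
      = (\<Sum>i<m * n. (cmod (u $ (i div n)))\<^sup>2 * (cmod (v $ (i mod n)))\<^sup>2)"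
    using u v by (intro sum.cong) (auto simp: kron_vec_def norm_mult power_mult_distrib)
  also have "\<dots> = (\<Sum>i<m. (cmod (u $ i))\<^sup>2) * (\<Sum>i<n. (cmod (v $ i))\<^sup>2)"
    by (subst sum_div_mod[of "\<lambda>x y. (cmod (u $ x))\<^sup>2 * (cmod (v $ y))\<^sup>2"]) (simp add: sum_product)
  finally show ?thesis by (simp add: l2_def L2_set_def real_sqrt_mult)
qed

lemma l2_unit_vec: "0 < n \<Longrightarrow> l2 {..<n} (unit_vec n 0) = 1"
proof -
  assume n: "0 < n"
  have "(\<Sum>i<n. (cmod (unit_vec n 0 $ i))\<^sup>2) = (\<Sum>i<n. if i = 0 then 1 else 0)"
    using n by (intro sum.cong) auto
  then show ?thesis using n by (simp add: l2_def L2_set_def)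
qed

section \<open>State vectors along the run of a query algorithm\<close>

definition initial_vec :: "nat \<Rightarrow> query_alg \<Rightarrow> complex vec" where
  "initial_vec a alg =
    kron_vec (unit_vec (env_dim alg) 0) (kron_vec (unit_vec (2 ^ a) 0) (init_vec alg))"

text \<open>The vector behind \<open>state_after\<close>: the initial state is pure and all
  operations are unitary, so a single vector carries the whole run.\<close>

primrec vec_after :: "nat \<Rightarrow> query_alg \<Rightarrow> complex mat \<Rightarrow> nat \<Rightarrow> complex vec" where
  "vec_after a alg U 0 = gates alg 0 *\<^sub>v initial_vec a alg"
| "vec_after a alg U (Suc i) = gates alg (Suc i) *\<^sub>v
     (kron (1\<^sub>m (env_dim alg)) (signed (signs alg (Suc i)) U) *\<^sub>v vec_after a alg U i)"

lemma unitary_mat_signed: "unitary_mat n U \<Longrightarrow> unitary_mat n (signed s U)"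
  by (cases s) (auto intro: unitary_mat_adjoint)

text \<open>The dimension claim feeds the other two in the induction step, so all three are carried
  at once.\<close>

lemma state_after_eq:
  assumes alg: "query_algorithm a d Q alg" and U: "unitary_mat (2 ^ a * d) U"
  shows "t \<le> Q \<Longrightarrow> vec_after a alg U t \<in> carrier_vec (env_dim alg * (2 ^ a * d)) \<and>
    l2 {..<env_dim alg * (2 ^ a * d)} (vec_after a alg U t) = 1 \<and>
    state_after a alg U t = pure_state (vec_after a alg U t)"
proof (induction t)
  case 0
  have init: "init_vec alg \<in> carrier_vec d" "init_vec alg \<bullet>c init_vec alg = 1"
    and e: "0 < env_dim alg"
    and G: "unitary_mat (env_dim alg * (2 ^ a * d)) (gates alg 0)"
    using alg by (auto simp: query_algorithm_def)
  have c: "initial_vec a alg \<in> carrier_vec (env_dim alg * (2 ^ a * d))"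
    using init by (simp add: initial_vec_def)
  have "complex_of_real (\<Sum>i<d. (cmod (init_vec alg $ i))\<^sup>2) = 1"
    using init cscalar_prod_self[OF init(1)] by simp
  then have "(\<Sum>i<d. (cmod (init_vec alg $ i))\<^sup>2) = 1"
    by (simp only: of_real_eq_1_iff)
  then have "l2 {..<d} (init_vec alg) = 1" by (simp add: l2_def L2_set_def)
  then have "l2 {..<env_dim alg * (2 ^ a * d)} (initial_vec a alg) = 1"
    unfolding initial_vec_def using e init
    by (simp add: l2_kron_vec[of _ "env_dim alg" _ "2 ^ a * d"] l2_kron_vec[of _ "2 ^ a" _ d] l2_unit_vec)
  moreover have "initial_state a alg = pure_state (initial_vec a alg)"
    unfolding initial_state_def initial_vec_def using init
    by (simp add: pure_state_kron_vec[of _ "env_dim alg" _ "2 ^ a * d"] pure_state_kron_vec[of _ "2 ^ a" _ d])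
  ultimately show ?case
    using c unitary_matD[OF G] l2_unitary[OF G c]
    by (simp add: unitary_channel_pure_state[of _ "env_dim alg * (2 ^ a * d)"])
next
  case (Suc t)
  let ?N = "env_dim alg * (2 ^ a * d)"
  let ?O = "kron (1\<^sub>m (env_dim alg)) (signed (signs alg (Suc t)) U)"
  have G: "unitary_mat ?N (gates alg (Suc t))"
    using alg Suc.prems by (auto simp: query_algorithm_def)
  have Orc: "unitary_mat ?N ?O" by (intro unitary_mat_kron_one unitary_mat_signed U)
  note G' = unitary_matD[OF G] and O' = unitary_matD[OF Orc]
  have c: "vec_after a alg U t \<in> carrier_vec ?N" using Suc by simp
  then have c': "?O *\<^sub>v vec_after a alg U t \<in> carrier_vec ?N" using O' by simp
  show ?case
    using Suc c c' G' O' l2_unitary[OF G c'] l2_unitary[OF Orc c]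
    by (simp add: query_channel_def unitary_channel_pure_state[of _ ?N])
qed

lemmas vec_after_carrier = state_after_eq[THEN conjunct1]
lemmas l2_vec_after = state_after_eq[THEN conjunct2, THEN conjunct1]
lemmas state_after_pure = state_after_eq[THEN conjunct2, THEN conjunct2]

section \<open>The output state and its diagonal\<close>

lemma alg_output_carrier [simp]: "alg_output a d Q alg U \<in> carrier_mat d d"
  by (simp add: alg_output_def partial_trace_left_def)

lemma index_alg_output:
  assumes alg: "query_algorithm a d Q alg" and U: "unitary_mat (2 ^ a * d) U"
    and ij: "i < d" "j < d"
  shows "alg_output a d Q alg U $$ (i, j) = (\<Sum>k<env_dim alg * 2 ^ a.
    vec_after a alg U Q $ (k * d + i) * cnj (vec_after a alg U Q $ (k * d + j)))"
proof -
  have "k * d + i < env_dim alg * (2 ^ a * d)" if "k < env_dim alg * 2 ^ a" "i < d" for k i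
  proof -
    have "k * d + i < Suc k * d" using that by simp
    also have "\<dots> \<le> (env_dim alg * 2 ^ a) * d" using that by (intro mult_le_mono1) auto
    finally show ?thesis by (simp add: mult.assoc)
  qed
  then show ?thesis
    using ij unfolding alg_output_def partial_trace_left_def state_after_pure[OF alg U order_refl]
    by (auto simp: index_pure_state[OF vec_after_carrier[OF alg U order_refl]] intro!: sum.cong)
qed

lemma mat_adjoint_alg_output:
  assumes "query_algorithm a d Q alg" "unitary_mat (2 ^ a * d) U"
  shows "mat_adjoint (alg_output a d Q alg U) = alg_output a d Q alg U"
  by (intro eq_matI)
    (auto simp: index_alg_output[OF assms] mult.commute carrier_matD[OF alg_output_carrier])

text \<open>The diagonal of the output holds the outcome probabilities on the last tensor factor.
  That factor is the least significant one, hence the weight of coordinate \<open>n\<close> depends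
  on \<open>n mod d\<close>.\<close>

lemma weighted_diag_alg_output:
  assumes "query_algorithm a d Q alg" "unitary_mat (2 ^ a * d) U"
  shows "(\<Sum>i<d. w i * Re (alg_output a d Q alg U $$ (i, i)))
    = (\<Sum>n<env_dim alg * (2 ^ a * d). w (n mod d) * (cmod (vec_after a alg U Q $ n))\<^sup>2)"
proof -
  let ?v = "vec_after a alg U Q"
  have "(\<Sum>i<d. w i * Re (alg_output a d Q alg U $$ (i, i)))
      = (\<Sum>i<d. \<Sum>k<env_dim alg * 2 ^ a. w i * (cmod (?v $ (k * d + i)))\<^sup>2)"
    by (intro sum.cong refl)
      (simp add: index_alg_output[OF assms] sum_distrib_left flip: complex_norm_square
        del: of_real_power)
  also have "\<dots> = (\<Sum>k<env_dim alg * 2 ^ a. \<Sum>i<d. w i * (cmod (?v $ (k * d + i)))\<^sup>2)"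
    by (rule sum.swap)
  also have "\<dots> = (\<Sum>n<(env_dim alg * 2 ^ a) * d. w (n mod d) * (cmod (?v $ (n div d * d + n mod d)))\<^sup>2)"
    by (rule sum_div_mod[symmetric])
  finally show ?thesis by (simp add: mult.assoc)
qed

section \<open>Reflections as block encodings\<close>

text \<open>Block-diagonal matrices: one \<open>m \<times> m\<close> matrix \<open>G i\<close> for every basis vector \<open>i\<close> of the right
  tensor factor.\<close>

definition fibred_mat :: "nat \<Rightarrow> nat \<Rightarrow> (nat \<Rightarrow> nat \<Rightarrow> nat \<Rightarrow> complex) \<Rightarrow> complex mat" where
  "fibred_mat m d G = mat (m * d) (m * d)
    (\<lambda>(p, q). if p mod d = q mod d then G (p mod d) (p div d) (q div d) else 0)"

lemma carrier_fibred_mat [simp]: "fibred_mat m d G \<in> carrier_mat (m * d) (m * d)"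
  and dim_fibred_mat [simp]: "dim_row (fibred_mat m d G) = m * d" "dim_col (fibred_mat m d G) = m * d"
  by (simp_all add: fibred_mat_def)

text \<open>Both factors connect only indices with equal residue modulo \<open>d\<close>, so the
  product is formed separately in each fibre.\<close>

lemma fibred_mat_mult:
  "fibred_mat m d G * fibred_mat m d H = fibred_mat m d (\<lambda>i k l. \<Sum>j<m. G i k j * H i j l)"
proof (intro eq_matI)
  fix p q assume "p < dim_row (fibred_mat m d (\<lambda>i k l. \<Sum>j<m. G i k j * H i j l))"
    "q < dim_col (fibred_mat m d (\<lambda>i k l. \<Sum>j<m. G i k j * H i j l))"
  then have pq: "p < m * d" "q < m * d" by auto
  have "(fibred_mat m d G * fibred_mat m d H) $$ (p, q)
      = (\<Sum>s<m * d. fibred_mat m d G $$ (p, s) * fibred_mat m d H $$ (s, q))"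
    using pq by (intro index_mult_mat_sum) auto
  also have "\<dots> = (\<Sum>s<m * d. if p mod d = s mod d \<and> s mod d = q mod d
      then G (p mod d) (p div d) (s div d) * H (p mod d) (s div d) (q div d) else 0)"
    using pq by (intro sum.cong) (auto simp: fibred_mat_def)
  also have "\<dots> = (\<Sum>j<m. \<Sum>i<d. if p mod d = i \<and> i = q mod d
      then G (p mod d) (p div d) j * H (p mod d) j (q div d) else 0)"
    by (rule sum_div_mod[of "\<lambda>j i. if p mod d = i \<and> i = q mod d
      then G (p mod d) (p div d) j * H (p mod d) j (q div d) else 0"])
  also have "\<dots> = (\<Sum>j<m. if p mod d = q mod d
      then G (p mod d) (p div d) j * H (p mod d) j (q div d) else 0)"
  proof (intro sum.cong refl)
    fix j
    have "(\<Sum>i<d. if p mod d = i \<and> i = q mod d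
          then G (p mod d) (p div d) j * H (p mod d) j (q div d) else 0)
        = (\<Sum>i<d. if i = p mod d then (if p mod d = q mod d
          then G (p mod d) (p div d) j * H (p mod d) j (q div d) else 0) else 0)"
      by (intro sum.cong) auto
    then show "(\<Sum>i<d. if p mod d = i \<and> i = q mod d
          then G (p mod d) (p div d) j * H (p mod d) j (q div d) else 0)
        = (if p mod d = q mod d then G (p mod d) (p div d) j * H (p mod d) j (q div d) else 0)"
      using mod_less_of_less_mult[OF pq(1)] by simp
  qed
  also have "\<dots> = fibred_mat m d (\<lambda>i k l. \<Sum>j<m. G i k j * H i j l) $$ (p, q)"
    using pq by (simp add: fibred_mat_def)
  finally show "(fibred_mat m d G * fibred_mat m d H) $$ (p, q)
    = fibred_mat m d (\<lambda>i k l. \<Sum>j<m. G i k j * H i j l) $$ (p, q)" .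
qed auto

lemma fibred_mat_cong:
  assumes "\<And>i k l. i < d \<Longrightarrow> k < m \<Longrightarrow> l < m \<Longrightarrow> G i k l = H i k l"
  shows "fibred_mat m d G = fibred_mat m d H"
  using assms
  by (intro eq_matI) (auto simp: fibred_mat_def div_less_of_less_mult mod_less_of_less_mult)

lemma mat_adjoint_fibred_mat:
  "mat_adjoint (fibred_mat m d G) = fibred_mat m d (\<lambda>i k l. cnj (G i l k))"
  by (intro eq_matI) (auto simp: fibred_mat_def)

lemma fibred_mat_minus:
  "fibred_mat m d G - fibred_mat m d H = fibred_mat m d (\<lambda>i k l. G i k l - H i k l)"
  by (intro eq_matI) (auto simp: fibred_mat_def)

lemma fibred_mat_diag:
  "fibred_mat m d (\<lambda>i k l. if k = l then f i k else 0) = diag_of (m * d) (\<lambda>p. f (p mod d) (p div d))"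
proof (intro eq_matI)
  fix p q assume "p < dim_row (diag_of (m * d) (\<lambda>p. f (p mod d) (p div d)))"
    "q < dim_col (diag_of (m * d) (\<lambda>p. f (p mod d) (p div d)))"
  moreover have "p = q" if "p div d = q div d" "p mod d = q mod d"
    using that by (metis div_mult_mod_eq)
  ultimately show "fibred_mat m d (\<lambda>i k l. if k = l then f i k else 0) $$ (p, q)
    = diag_of (m * d) (\<lambda>p. f (p mod d) (p div d)) $$ (p, q)"
    by (auto simp: fibred_mat_def)
qed auto

text \<open>The matrix \<open>(x, y; y, -x)\<close> on the span of \<open>|0\<rangle>\<close> and \<open>|1\<rangle>\<close>, and \<open>z\<close> times the identity on
  the other basis vectors.\<close>

definition refl_entry :: "real \<Rightarrow> real \<Rightarrow> real \<Rightarrow> nat \<Rightarrow> nat \<Rightarrow> complex" where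
  "refl_entry x y z k l = complex_of_real
    (if k < 2 \<and> l < 2 then (if k \<noteq> l then y else if k = 0 then x else - x)
     else if k = l then z else 0)"

lemma cnj_refl_entry: "cnj (refl_entry x y z l k) = refl_entry x y z k l"
  by (auto simp: refl_entry_def)

text \<open>The off-diagonal terms \<open>x * y\<close> and \<open>- x * y\<close> in the square of
  the two-dimensional block cancel. Since \<open>x\<close>, \<open>y\<close>, \<open>z\<close> are
  arbitrary, the formula serves both the reflections and their differences.\<close>

lemma refl_entry_square:
  assumes "2 \<le> m" "k < m" "l < m"
  shows "(\<Sum>j<m. refl_entry x y z k j * refl_entry x y z j l)
    = (if k = l then complex_of_real (if k < 2 then x\<^sup>2 + y\<^sup>2 else z\<^sup>2) else 0)"
proof (cases "k < 2")
  case True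
  \<comment> \<open>For \<open>k < 2\<close>, row \<open>k\<close> is supported on the first two
    columns.\<close>
  have "(\<Sum>j<m. refl_entry x y z k j * refl_entry x y z j l)
      = (\<Sum>j\<in>{0, 1}. refl_entry x y z k j * refl_entry x y z j l)"
    using assms True by (intro sum.mono_neutral_right) (auto simp: refl_entry_def)
  moreover have "k = 0 \<or> k = 1" using True by auto
  moreover have "l = 0 \<or> l = 1 \<or> l \<ge> 2" by auto
  ultimately show ?thesis
    by (auto simp: refl_entry_def power2_eq_square)
next
  case False
  have "(\<Sum>j<m. refl_entry x y z k j * refl_entry x y z j l)
      = (\<Sum>j\<in>{k}. refl_entry x y z k j * refl_entry x y z j l)"
    using assms False by (intro sum.mono_neutral_right) (auto simp: refl_entry_def)
  then show ?thesis using False by (auto simp: refl_entry_def power2_eq_square)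
qed

text \<open>For entries \<open>s i\<close> of modulus at most 1, this is a Hermitian unitary
  dilation of the diagonal matrix they form: the choice of \<open>y\<close> makes each
  two-dimensional block a reflection, and \<open>z = 1\<close> makes the remaining ancilla levels
  trivial.\<close>

definition refl_mat :: "nat \<Rightarrow> nat \<Rightarrow> (nat \<Rightarrow> real) \<Rightarrow> complex mat" where
  "refl_mat m d s = fibred_mat m d (\<lambda>i. refl_entry (s i) (sqrt (1 - (s i)\<^sup>2)) 1)"

lemma mat_adjoint_refl_mat: "mat_adjoint (refl_mat m d s) = refl_mat m d s"
  by (simp add: refl_mat_def mat_adjoint_fibred_mat cnj_refl_entry)

text \<open>The matrix is self-adjoint, so unitarity amounts to squaring to the identity.\<close>

lemma unitary_refl_mat:
  assumes m: "2 \<le> m" and s: "\<And>i. i < d \<Longrightarrow> \<bar>s i\<bar> \<le> 1"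
  shows "unitary_mat (m * d) (refl_mat m d s)"
proof -
  have "refl_mat m d s * refl_mat m d s = fibred_mat m d (\<lambda>i k l. if k = l then 1 else 0)"
    unfolding refl_mat_def fibred_mat_mult
  proof (rule fibred_mat_cong)
    fix i k l assume *: "i < d" "k < m" "l < m"
    have "(s i)\<^sup>2 \<le> 1" using s[OF *(1)] by (simp add: abs_square_le_1)
    then show "(\<Sum>j<m. refl_entry (s i) (sqrt (1 - (s i)\<^sup>2)) 1 k j *
        refl_entry (s i) (sqrt (1 - (s i)\<^sup>2)) 1 j l) = (if k = l then 1 else 0)"
      using refl_entry_square[OF m *(2,3)] by simp
  qed
  also have "\<dots> = 1\<^sub>m (m * d)" by (simp add: fibred_mat_diag diag_of_one)
  finally show ?thesis
    by (intro unitary_matI) (auto simp: mat_adjoint_refl_mat, simp add: refl_mat_def)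
qed

text \<open>In the difference the identity parts on the ancilla levels from 2 on cancel. The rest
  again has the shape \<open>refl_entry\<close>, with \<open>y\<close> lowered by 1 and
  \<open>z = 0\<close>, so its square is diagonal.\<close>

lemma refl_mat_minus_square:
  fixes s :: "nat \<Rightarrow> real" and d :: nat
  assumes m: "2 \<le> m"
  defines "E \<equiv> refl_mat m d s - refl_mat m d (\<lambda>_. 0)"
  shows "mat_adjoint E * E = diag_of (m * d) (\<lambda>p. complex_of_real (if p div d < 2
    then (s (p mod d))\<^sup>2 + (sqrt (1 - (s (p mod d))\<^sup>2) - 1)\<^sup>2 else 0))"
proof -
  have E: "E = fibred_mat m d (\<lambda>i. refl_entry (s i) (sqrt (1 - (s i)\<^sup>2) - 1) 0)"
    unfolding E_def refl_mat_def fibred_mat_minus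
    by (rule fibred_mat_cong) (auto simp: refl_entry_def)
  have "mat_adjoint E * E = fibred_mat m d (\<lambda>i k l. if k = l then
    complex_of_real (if k < 2 then (s i)\<^sup>2 + (sqrt (1 - (s i)\<^sup>2) - 1)\<^sup>2 else 0) else 0)"
    unfolding E mat_adjoint_fibred_mat fibred_mat_mult cnj_refl_entry
    by (rule fibred_mat_cong) (simp add: refl_entry_square[OF m])
  then show ?thesis by (simp only: fibred_mat_diag)
qed

text \<open>Source of the \<open>sqrt 2\<close> in \<kappa>. With \<open>c = sqrt (1 - s^2)\<close>,
  the left-hand side is the squared distance between the points (s, c) and (0, 1) of the unit
  circle, and \<open>(1 - c)^2 \<le> 1 - c^2 = s^2\<close> because c lies between 0 and 1.\<close>

lemma chord_bound:
  fixes s :: real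
  assumes "\<bar>s\<bar> \<le> 1"
  shows "s\<^sup>2 + (sqrt (1 - s\<^sup>2) - 1)\<^sup>2 \<le> 2 * s\<^sup>2"
proof -
  define c where "c = sqrt (1 - s\<^sup>2)"
  have "s\<^sup>2 \<le> 1" using assms by (simp add: abs_square_le_1)
  then have c: "0 \<le> c" "c\<^sup>2 = 1 - s\<^sup>2" by (simp_all add: c_def)
  then have "c\<^sup>2 \<le> 1\<^sup>2" by simp
  then have "c \<le> 1" by (rule power2_le_imp_le) simp
  then have "0 \<le> c * (1 - c)" using c by simp
  then have "(c - 1)\<^sup>2 \<le> 1 - c\<^sup>2" by (simp add: power2_eq_square algebra_simps)
  then show ?thesis using c by (simp add: c_def)
qed

text \<open>The ancilla is the most significant factor, so projecting it onto its zero state cuts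
  out the top left \<open>d\<close> by \<open>d\<close> corner. This corner is diagonal with entries
  \<open>p i / \<alpha>\<close>.\<close>

lemma block_encoding_refl_mat:
  assumes \<alpha>: "0 < \<alpha>" and p: "\<And>i. i < d \<Longrightarrow> \<bar>p i\<bar> \<le> \<alpha>" and a: "1 \<le> a"
  shows "block_encoding \<alpha> a d (refl_mat (2 ^ a) d (\<lambda>i. p i / \<alpha>)) (diag_of d (\<lambda>i. complex_of_real (p i)))"
  unfolding block_encoding_def
proof
  let ?m = "2 ^ a :: nat"
  let ?U = "refl_mat ?m d (\<lambda>i. p i / \<alpha>)"
  let ?B = "kron (bra (unit_vec ?m 0)) (1\<^sub>m d)" and ?K = "kron (ket (unit_vec ?m 0)) (1\<^sub>m d)"
  have m: "2 \<le> ?m" using power_increasing[of 1 a "2::nat"] a by simp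
  show U: "unitary_mat (?m * d) ?U"
    using \<alpha> p by (intro unitary_refl_mat m) auto
  have Uc: "?U \<in> carrier_mat (?m * d) (?m * d)" using unitary_matD[OF U] by simp
  have B: "?B \<in> carrier_mat (Suc 0 * d) (?m * d)" and K: "?K \<in> carrier_mat (?m * d) (Suc 0 * d)"
    by (intro carrier_kron; simp)+
  have dm: "n < ?m * d" if "n < d" for n
  proof -
    have "1 * d \<le> ?m * d" using m by (intro mult_le_mono1) simp
    then show ?thesis using that by linarith
  qed
  have Bi: "?B $$ (i, n) = (if n = i then 1 else 0)" if "i < d" "n < ?m * d" for i n
  proof -
    have "?B $$ (i, n) = bra (unit_vec ?m 0) $$ (i div d, n div d) * 1\<^sub>m d $$ (i mod d, n mod d)"
      using that by (intro index_kron[of _ "Suc 0" ?m]) auto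
    also have "\<dots> = (if n div d = 0 \<and> i = n mod d then 1 else 0)"
      using that div_less_of_less_mult[OF that(2)] mod_less_of_less_mult[OF that(2)]
      by (auto simp: index_bra[of _ ?m])
    also have "(n div d = 0 \<and> i = n mod d) = (n = i)"
      using that by (auto simp: div_eq_0_iff)
    finally show ?thesis .
  qed
  have Ki: "?K $$ (n, i) = (if n = i then 1 else 0)" if "i < d" "n < ?m * d" for i n
  proof -
    have "?K $$ (n, i) = ket (unit_vec ?m 0) $$ (n div d, i div d) * 1\<^sub>m d $$ (n mod d, i mod d)"
      using that by (intro index_kron[of _ ?m "Suc 0"]) auto
    also have "\<dots> = (if n div d = 0 \<and> i = n mod d then 1 else 0)"
      using that div_less_of_less_mult[OF that(2)] mod_less_of_less_mult[OF that(2)]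
      by (auto simp: index_ket[of _ ?m])
    also have "(n div d = 0 \<and> i = n mod d) = (n = i)"
      using that by (auto simp: div_eq_0_iff)
    finally show ?thesis .
  qed
  have BU: "(?B * ?U) $$ (i, n) = ?U $$ (i, n)" if "i < d" "n < ?m * d" for i n
  proof -
    have "(?B * ?U) $$ (i, n) = (\<Sum>k<?m * d. ?B $$ (i, k) * ?U $$ (k, n))"
      using that B Uc by (intro index_mult_mat_sum) auto
    also have "\<dots> = (\<Sum>k<?m * d. if k = i then ?U $$ (i, n) else 0)"
      using that Bi by (intro sum.cong) auto
    finally show ?thesis using dm[OF that(1)] by simp
  qed
  have BUK: "(?B * ?U * ?K) $$ (i, j) = ?U $$ (i, j)" if "i < d" "j < d" for i j
  proof -
    have "(?B * ?U * ?K) $$ (i, j) = (\<Sum>k<?m * d. (?B * ?U) $$ (i, k) * ?K $$ (k, j))"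
      using that B Uc K mult_carrier_mat[OF B Uc] by (intro index_mult_mat_sum) auto
    also have "\<dots> = (\<Sum>k<?m * d. if k = j then ?U $$ (i, j) else 0)"
      using that BU Ki by (intro sum.cong) auto
    finally show ?thesis using dm[OF that(2)] by simp
  qed
  show "complex_of_real \<alpha> \<cdot>\<^sub>m (?B * ?U * ?K) = diag_of d (\<lambda>i. complex_of_real (p i))"
  proof (intro eq_matI)
    fix i j assume "i < dim_row (diag_of d (\<lambda>i. complex_of_real (p i)))"
      "j < dim_col (diag_of d (\<lambda>i. complex_of_real (p i)))"
    then have ij: "i < d" "j < d" by auto
    then have "(complex_of_real \<alpha> \<cdot>\<^sub>m (?B * ?U * ?K)) $$ (i, j) = complex_of_real \<alpha> * ?U $$ (i, j)"
      using BUK carrier_matD[OF mult_carrier_mat[OF mult_carrier_mat[OF B Uc] K]]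
      by (subst index_smult_mat(1)) (simp_all del: index_mult_mat(1))
    also have "\<dots> = diag_of d (\<lambda>i. complex_of_real (p i)) $$ (i, j)"
      using ij dm \<alpha> by (simp add: refl_mat_def fibred_mat_def refl_entry_def)
    finally show "(complex_of_real \<alpha> \<cdot>\<^sub>m (?B * ?U * ?K)) $$ (i, j)
      = diag_of d (\<lambda>i. complex_of_real (p i)) $$ (i, j)" .
  qed (use B K in auto)
qed

text \<open>The difference \<open>K\<close> of the two oracles has \<open>mat_adjoint K * K\<close>
  diagonal, with entries at most \<open>2 * \<sigma>^2\<close> on the block and zero elsewhere, so
  only the component of \<open>\<psi>\<close> on the block contributes.\<close>

lemma l2_refl_mat_minus:
  assumes m: "2 \<le> m" and s: "\<And>i. i < d \<Longrightarrow> i \<in> B \<Longrightarrow> \<bar>s i\<bar> \<le> \<sigma>" "\<And>i. i \<notin> B \<Longrightarrow> s i = 0"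
    and \<sigma>: "\<sigma> \<le> 1" and \<psi>: "\<psi> \<in> carrier_vec (e * (m * d))"
  shows "l2 {..<e * (m * d)}
      (kron (1\<^sub>m e) (refl_mat m d s) *\<^sub>v \<psi> - kron (1\<^sub>m e) (refl_mat m d (\<lambda>_. 0)) *\<^sub>v \<psi>)
    \<le> sqrt 2 * \<sigma> * l2 {n. n < e * (m * d) \<and> n mod d \<in> B} \<psi>"
proof (cases "{n. n < e * (m * d) \<and> n mod d \<in> B} = {}")
  case False
  let ?N = "e * (m * d)"
  let ?S = "{n. n < ?N \<and> n mod d \<in> B}"
  define E where "E = refl_mat m d s - refl_mat m d (\<lambda>_. 0)"
  define K where "K = kron (1\<^sub>m e) E"
  \<comment> \<open>Reduction modulo \<open>m * d\<close> strips the environment index; the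
    following \<open>div d\<close> yields the ancilla index.\<close>
  define w where "w n = (if n mod (m * d) div d < 2
    then (s (n mod d))\<^sup>2 + (sqrt (1 - (s (n mod d))\<^sup>2) - 1)\<^sup>2 else 0)" for n
  have R: "refl_mat m d t \<in> carrier_mat (m * d) (m * d)" for t by (simp add: refl_mat_def)
  have E: "E \<in> carrier_mat (m * d) (m * d)"
    unfolding E_def by (rule minus_carrier_mat[OF R])
  have K: "K \<in> carrier_mat ?N ?N" using E by (simp add: K_def)
  obtain n0 where n0: "n0 < ?N" "n0 mod d \<in> B" using False by auto
  then have d: "0 < d" by (cases d) auto
  \<comment> \<open>A coordinate in \<open>?S\<close> supplies an index below \<open>d\<close> in
    \<open>B\<close>, which forces \<sigma> to be nonnegative.\<close>
  have "n0 mod d < d" using d by simp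
  then have \<sigma>0: "0 \<le> \<sigma>" using s(1)[of "n0 mod d"] n0 by linarith
  have mm: "n mod (m * d) mod d = n mod d" for n by (rule mod_mod_cancel) simp
  have "mat_adjoint K * K = kron (1\<^sub>m e) (mat_adjoint E * E)"
    using E by (simp add: K_def mat_adjoint_kron kron_mult[of _ e e _ "m * d" "m * d" _ e _ "m * d"])
  also have "\<dots> = diag_of ?N (\<lambda>n. complex_of_real (w n))"
    unfolding E_def refl_mat_minus_square[OF m] kron_one_diag
    by (simp only: w_def mm)
  finally have KK: "mat_adjoint K * K = diag_of ?N (\<lambda>n. complex_of_real (w n))" .
  have w: "w n \<le> (if n \<in> ?S then 2 * \<sigma>\<^sup>2 else 0)" if "n < ?N" for n
  proof (cases "n mod d \<in> B")
    case True
    then have sn: "\<bar>s (n mod d)\<bar> \<le> \<sigma>" using s(1) d by simp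
    then have "(s (n mod d))\<^sup>2 \<le> \<sigma>\<^sup>2" by (simp add: abs_le_square_iff[symmetric])
    then have "(s (n mod d))\<^sup>2 + (sqrt (1 - (s (n mod d))\<^sup>2) - 1)\<^sup>2 \<le> 2 * \<sigma>\<^sup>2"
      using chord_bound[of "s (n mod d)"] sn \<sigma> by linarith
    then show ?thesis using True that by (simp add: w_def)
  next
    case False
    then show ?thesis using s(2) by (simp add: w_def)
  qed
  have "(l2 {..<?N} (K *\<^sub>v \<psi>))\<^sup>2 = (\<Sum>n<?N. w n * (cmod (\<psi> $ n))\<^sup>2)"
    unfolding l2_square by (rule sum_norm_mult_mat_vec[OF K KK \<psi>])
  also have "\<dots> \<le> (\<Sum>n<?N. (if n \<in> ?S then 2 * \<sigma>\<^sup>2 else 0) * (cmod (\<psi> $ n))\<^sup>2)"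
    using w by (intro sum_mono mult_right_mono) auto
  also have "\<dots> = (\<Sum>n\<in>?S. (if n \<in> ?S then 2 * \<sigma>\<^sup>2 else 0) * (cmod (\<psi> $ n))\<^sup>2)"
    by (rule sum.mono_neutral_right) auto
  also have "\<dots> = (sqrt 2 * \<sigma> * l2 ?S \<psi>)\<^sup>2"
    by (simp add: power_mult_distrib l2_square sum_distrib_left)
  finally have "l2 {..<?N} (K *\<^sub>v \<psi>) \<le> sqrt 2 * \<sigma> * l2 ?S \<psi>"
    by (rule power2_le_imp_le) (use \<sigma>0 in simp)
  moreover have "K *\<^sub>v \<psi> = kron (1\<^sub>m e) (refl_mat m d s) *\<^sub>v \<psi> - kron (1\<^sub>m e) (refl_mat m d (\<lambda>_. 0)) *\<^sub>v \<psi>"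
    unfolding K_def E_def using R \<psi>
    by (subst kron_minus[symmetric, of _ e e _ "m * d" "m * d"])
      (auto intro!: minus_mult_distrib_mat_vec[of _ ?N ?N])
  ultimately show ?thesis by simp
next
  \<comment> \<open>Without coordinates in the block, the two oracles coincide if \<open>e\<close>
    is nonzero, and the space is trivial if \<open>e = 0\<close>.\<close>
  case True
  let ?N = "e * (m * d)"
  have R: "refl_mat m d t \<in> carrier_mat (m * d) (m * d)" for t by (simp add: refl_mat_def)
  have eq: "refl_mat m d s = refl_mat m d (\<lambda>_. 0)" if "e \<noteq> 0"
    unfolding refl_mat_def
  proof (rule fibred_mat_cong)
    fix i k l assume i: "i < d" "k < m" "l < m"
    have "i < 1 * d" using i by simp
    also have "\<dots> \<le> (e * m) * d" using m that by (intro mult_le_mono1) (auto simp: Suc_le_eq)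
    finally have "i < ?N" by (simp add: mult.assoc)
    then have "i \<notin> B" using True i by auto
    then show "refl_entry (s i) (sqrt (1 - (s i)\<^sup>2)) 1 k l = refl_entry 0 (sqrt (1 - 0\<^sup>2)) 1 k l"
      using s(2) by simp
  qed
  have "kron (1\<^sub>m e) (refl_mat m d s) *\<^sub>v \<psi> - kron (1\<^sub>m e) (refl_mat m d (\<lambda>_. 0)) *\<^sub>v \<psi> = 0\<^sub>v ?N"
    using eq R \<psi> by (cases "e = 0") (auto intro!: eq_vecI simp: refl_mat_def)
  then show ?thesis unfolding True by (simp add: l2_def L2_set_def)
qed

section \<open>The hybrid bound\<close>

lemma minus_vec_split:
  fixes x y z :: "complex vec"
  assumes "x \<in> carrier_vec n" "y \<in> carrier_vec n" "z \<in> carrier_vec n"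
  shows "x - z = (x - y) + (y - z)"
  using assms by (intro eq_vecI) auto

text \<open>Induction over the queries: unitarity preserves the difference accumulated so far, and
  each step adds the error of one exchanged query. Self-adjointness of both oracles makes the query
  signs immaterial.\<close>

lemma l2_hybrid:
  assumes alg: "query_algorithm a d Q alg"
    and U: "unitary_mat (2 ^ a * d) U" "mat_adjoint U = U"
    and V: "unitary_mat (2 ^ a * d) V" "mat_adjoint V = V"
    and diff: "\<And>\<psi>. \<psi> \<in> carrier_vec (env_dim alg * (2 ^ a * d)) \<Longrightarrow>
      l2 {..<env_dim alg * (2 ^ a * d)} (kron (1\<^sub>m (env_dim alg)) U *\<^sub>v \<psi> - kron (1\<^sub>m (env_dim alg)) V *\<^sub>v \<psi>)
        \<le> \<kappa> * l2 S \<psi>"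
  shows "t \<le> Q \<Longrightarrow> l2 {..<env_dim alg * (2 ^ a * d)} (vec_after a alg U t - vec_after a alg V t)
    \<le> \<kappa> * (\<Sum>i<t. l2 S (vec_after a alg V i))"
proof (induction t)
  case 0
  have "gates alg 0 \<in> carrier_mat (env_dim alg * (2 ^ a * d)) (env_dim alg * (2 ^ a * d))"
    using alg by (auto simp: query_algorithm_def unitary_mat_def)
  then have "vec_after a alg U 0 - vec_after a alg V 0 = 0\<^sub>v (env_dim alg * (2 ^ a * d))"
    by (intro eq_vecI) auto
  then show ?case by (simp add: l2_def L2_set_def)
next
  case (Suc t)
  let ?N = "env_dim alg * (2 ^ a * d)"
  let ?U = "kron (1\<^sub>m (env_dim alg)) U" and ?V = "kron (1\<^sub>m (env_dim alg)) V"
  let ?u = "vec_after a alg U t" and ?v = "vec_after a alg V t"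
  have sg: "signed s U = U" "signed s V = V" for s using U V by (cases s; simp)+
  have G: "unitary_mat ?N (gates alg (Suc t))"
    using alg Suc.prems by (auto simp: query_algorithm_def)
  have UU: "unitary_mat ?N ?U" and VV: "unitary_mat ?N ?V"
    using U V by (auto intro: unitary_mat_kron_one)
  note c = unitary_matD(1)[OF UU] unitary_matD(1)[OF VV] unitary_matD(1)[OF G]
  have uv: "?u \<in> carrier_vec ?N" "?v \<in> carrier_vec ?N"
    using Suc.prems vec_after_carrier[OF alg U(1), of t] vec_after_carrier[OF alg V(1), of t] by auto
  have "vec_after a alg U (Suc t) - vec_after a alg V (Suc t) = gates alg (Suc t) *\<^sub>v (?U *\<^sub>v ?u - ?V *\<^sub>v ?v)"
    using c uv by (simp add: sg mult_minus_distrib_mat_vec[of _ ?N ?N])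
  then have "l2 {..<?N} (vec_after a alg U (Suc t) - vec_after a alg V (Suc t))
      = l2 {..<?N} (?U *\<^sub>v ?u - ?V *\<^sub>v ?v)"
    using c uv by (simp add: l2_unitary[OF G])
  \<comment> \<open>The exchange is made on the reference run \<open>?v\<close>, so the error refers
    to amplitudes of the run with \<open>V\<close> alone.\<close>
  also have "?U *\<^sub>v ?u - ?V *\<^sub>v ?v = ?U *\<^sub>v (?u - ?v) + (?U *\<^sub>v ?v - ?V *\<^sub>v ?v)"
    unfolding mult_minus_distrib_mat_vec[OF c(1) uv]
    using c uv by (intro minus_vec_split[of _ ?N]) auto
  also have "l2 {..<?N} \<dots> \<le> l2 {..<?N} (?U *\<^sub>v (?u - ?v)) + l2 {..<?N} (?U *\<^sub>v ?v - ?V *\<^sub>v ?v)"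
    using c uv by (intro l2_add[of _ ?N]) auto
  also have "\<dots> \<le> \<kappa> * (\<Sum>i<t. l2 S (vec_after a alg V i)) + \<kappa> * l2 S ?v"
    using Suc uv diff[OF uv(2)] l2_unitary[OF UU, of "?u - ?v"] by (intro add_mono) auto
  finally show ?case by (simp add: distrib_left)
qed

section \<open>The family of hard states\<close>

text \<open>\<open>p\<close> enumerates the nonzero eigenvalues with multiplicity. Discarding the
  zeros changes neither the sum nor the maximum.\<close>

lemma rank_state_spectrum:
  assumes \<rho>: "rank_state d r \<rho>"
  obtains p :: "nat \<Rightarrow> real" where "\<And>j. j < r \<Longrightarrow> 0 < p j" "(\<Sum>j<r. p j) = 1"
    "Max (p ` {..<r}) = lambda_max \<rho>"
proof -
  have psd: "psd_mat d \<rho>" and tr: "mat_trace \<rho> = 1" and rk: "vec_space.rank d \<rho> = r"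
    using \<rho> by (auto simp: rank_state_def quantum_state_def)
  obtain U D where U: "unitary_mat d U" and D: "\<And>i. i < d \<Longrightarrow> 0 \<le> D i"
    and \<rho>U: "\<rho> = U * diag_of d (\<lambda>i. complex_of_real (D i)) * mat_adjoint U"
    using psd_spectral[OF psd] by metis
  let ?I = "{i. i < d \<and> D i \<noteq> 0}"
  have cI: "card ?I = r" using rank_conj_diag[OF U, of "\<lambda>i. complex_of_real (D i)"] rk \<rho>U by simp
  have "complex_of_real (\<Sum>i<d. D i) = 1" using tr mat_trace_conj_diag[OF U] \<rho>U by simp
  then have sD: "(\<Sum>i<d. D i) = 1" by (simp only: of_real_eq_1_iff)
  have sI: "(\<Sum>i\<in>?I. D i) = 1"
    unfolding sD[symmetric] by (rule sum.mono_neutral_left) auto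
  have "{x. eigenvalue \<rho> (complex_of_real x)} = D ` {..<d}"
    unfolding \<rho>U eigenvalue_conj_diag[OF U] by auto
  then have lam: "lambda_max \<rho> = Max (D ` {..<d})" by (simp add: lambda_max_def)
  obtain h where h: "bij_betw h {..<r} ?I"
    using ex_bij_betw_nat_finite[of ?I] cI by (auto simp: atLeast0LessThan)
  have h': "h j < d" "D (h j) \<noteq> 0" if "j < r" for j
    using bij_betwE[OF h] that by auto
  have I: "h ` {..<r} = ?I" using h by (auto simp: bij_betw_def)
  \<comment> \<open>The eigenvalues sum to 1, so they cannot all vanish.\<close>
  have ne: "?I \<noteq> {}"
  proof
    assume "?I = {}"
    with sI show False by (simp only: sum.empty zero_neq_one)
  qed
  have "Max (D ` ?I) = Max (D ` {..<d})"
  proof (rule antisym)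
    show "Max (D ` ?I) \<le> Max (D ` {..<d})" using ne by (intro Max_mono) auto
    have "D i \<le> Max (D ` ?I)" if "i < d" for i
    proof (cases "D i = 0")
      case True
      obtain j where "j \<in> ?I" using ne by auto
      then have "0 \<le> D j" "D j \<le> Max (D ` ?I)" using D by (auto intro: Max_ge)
      then show ?thesis using True by simp
    next
      case False
      then show ?thesis using that by (intro Max_ge) auto
    qed
    moreover have "0 < d" using ne by auto
    ultimately show "Max (D ` {..<d}) \<le> Max (D ` ?I)" by (intro Max.boundedI) auto
  qed
  then have "Max ((\<lambda>j. D (h j)) ` {..<r}) = lambda_max \<rho>"
    using lam I by (metis image_image)
  moreover have "(\<Sum>j<r. D (h j)) = 1"
    using sum.reindex_bij_betw[OF h, of D] sI by simp
  moreover have "0 < D (h j)" if "j < r" for j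
    using D[OF h'(1)[OF that]] h'(2)[OF that] by simp
  ultimately show thesis using that[of "\<lambda>j. D (h j)"] by blast
qed

text \<open>The general facts about a diagonalised matrix, applied with the identity as the
  diagonalising unitary.\<close>

lemma rank_state_diag:
  fixes q :: "nat \<Rightarrow> real"
  assumes q: "\<And>i. i < d \<Longrightarrow> 0 \<le> q i" "(\<Sum>i<d. q i) = 1" "card {i. i < d \<and> q i \<noteq> 0} = r"
  defines "\<rho> \<equiv> diag_of d (\<lambda>i. complex_of_real (q i))"
  shows "rank_state d r \<rho>" "lambda_max \<rho> = Max (q ` {..<d})"
proof -
  have one: "\<rho> = 1\<^sub>m d * diag_of d (\<lambda>i. complex_of_real (q i)) * mat_adjoint (1\<^sub>m d)"
    unfolding \<rho>_def mat_adjoint_one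
    by (simp add: left_mult_one_mat[OF carrier_diag_of] right_mult_one_mat[OF carrier_diag_of])
  note u = unitary_mat_one[of d]
  have "mat_trace \<rho> = complex_of_real (\<Sum>i<d. q i)"
    unfolding one mat_trace_conj_diag[OF u] by simp
  then show "rank_state d r \<rho>"
    unfolding rank_state_def quantum_state_def
    using q psd_mat_conj_diag[OF u q(1)] rank_conj_diag[OF u, of "\<lambda>i. complex_of_real (q i)"]
    by (simp add: one)
  have "{x. eigenvalue \<rho> (complex_of_real x)} = q ` {..<d}"
    unfolding one eigenvalue_conj_diag[OF u] by auto
  then show "lambda_max \<rho> = Max (q ` {..<d})" by (simp add: lambda_max_def)
qed

text \<open>Block \<open>x\<close> consists of the coordinates from \<open>x * r\<close> to
  \<open>x * r + r - 1\<close>. For \<open>x < d div r\<close> these all lie below \<open>d\<close>;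
  the \<open>d mod r\<close> leftover coordinates belong to no such block.\<close>

definition block_spectrum :: "nat \<Rightarrow> (nat \<Rightarrow> real) \<Rightarrow> nat \<Rightarrow> nat \<Rightarrow> real" where
  "block_spectrum r p x i = (if i div r = x then p (i mod r) else 0)"

lemma block_eq:
  fixes d r x :: nat
  assumes "0 < r" "x < d div r"
  shows "{i. i < d \<and> i div r = x} = (\<lambda>j. x * r + j) ` {..<r}"
proof (intro equalityI subsetI)
  fix i assume "i \<in> {i. i < d \<and> i div r = x}"
  then have "i = x * r + i mod r" "i mod r < r"
    using assms div_mult_mod_eq[of i r] by auto
  then show "i \<in> (\<lambda>j. x * r + j) ` {..<r}" by blast
next
  fix i assume "i \<in> (\<lambda>j. x * r + j) ` {..<r}"
  then obtain j where j: "j < r" "i = x * r + j" by auto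
  have "i < Suc x * r" using j by simp
  also have "\<dots> \<le> (d div r) * r" using assms by (intro mult_le_mono1) simp
  also have "\<dots> \<le> d" by simp
  finally show "i \<in> {i. i < d \<and> i div r = x}" using j by simp
qed

text \<open>Moving a nonzero spectrum to the coordinates of one block preserves rank and largest
  eigenvalue, so every block yields a state covered by the correctness assumption.\<close>

lemma block_state:
  fixes p :: "nat \<Rightarrow> real" and d :: nat
  assumes p: "\<And>j. j < r \<Longrightarrow> 0 < p j" "(\<Sum>j<r. p j) = 1" "Max (p ` {..<r}) = lam"
    and r: "0 < r" and x: "x < d div r"
  defines "\<rho> \<equiv> diag_of d (\<lambda>i. complex_of_real (block_spectrum r p x i))"
  shows "rank_state d r \<rho>" "lambda_max \<rho> = lam"
    "(\<Sum>i<d. block_spectrum r p x i) = 1"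
proof -
  let ?q = "block_spectrum r p x"
  let ?B = "{i. i < d \<and> i div r = x}"
  note B = block_eq[OF r x]
  have inj: "inj_on (\<lambda>j. x * r + j) {..<r}" by (auto intro: inj_onI)
  have q: "?q (x * r + j) = p j" if "j < r" for j
    using that by (simp add: block_spectrum_def)
  have "(\<Sum>i<d. ?q i) = (\<Sum>i\<in>?B. ?q i)"
    by (rule sum.mono_neutral_right) (auto simp: block_spectrum_def)
  also have "\<dots> = (\<Sum>j<r. p j)"
    unfolding B by (subst sum.reindex[OF inj]) (simp add: q)
  finally show s: "(\<Sum>i<d. ?q i) = 1" using p by simp
  have nonneg: "0 \<le> ?q i" for i
    using p(1)[of "i mod r"] r by (auto simp: block_spectrum_def less_imp_le)
  have "{i. i < d \<and> ?q i \<noteq> 0} = ?B"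
    using p(1) r by (auto simp: block_spectrum_def) (metis less_irrefl mod_less_divisor)
  then have c: "card {i. i < d \<and> ?q i \<noteq> 0} = r"
    unfolding B by (simp add: card_image[OF inj])
  show "rank_state d r \<rho>" unfolding \<rho>_def using nonneg s c by (intro rank_state_diag) auto
  have "lambda_max \<rho> = Max (?q ` {..<d})"
    unfolding \<rho>_def using nonneg s c by (intro rank_state_diag) auto
  also have "\<dots> = lam"
  proof (rule Max_eqI)
    have pl: "p j \<le> lam" if "j < r" for j using that p(3) by (metis Max_ge finite_imageI finite_lessThan imageI lessThan_iff)
    \<comment> \<open>Positivity of \<open>lam\<close> keeps the zeros outside the block below the
      maximum.\<close>
    have "0 < lam" using pl[OF r] p(1)[OF r] by linarith
    then show "y \<le> lam" if "y \<in> ?q ` {..<d}" for y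
      using that pl r by (auto simp: block_spectrum_def)
    have "lam \<in> p ` {..<r}" using Max_in[of "p ` {..<r}"] p(3) r by auto
    then obtain j where j: "j < r" "lam = p j" by auto
    then have "x * r + j \<in> ?B" unfolding B by auto
    then show "lam \<in> ?q ` {..<d}" using j q by (metis (mono_tags, lifting) imageI lessThan_iff mem_Collect_eq)
  qed simp
  finally show "lambda_max \<rho> = lam" .
qed

text \<open>Weighting block \<open>B\<close> by \<open>-1\<close> and its complement by \<open>1\<close> exploits that the error is traceless.
  The resulting \<open>\<epsilon> / 2\<close> is needed: with \<open>\<epsilon>\<close> the final bound would be void for \<open>\<epsilon>\<close> close to \<open>1\<close>.\<close>

lemma l2_block_ge:
  assumes alg: "query_algorithm a d Q alg" and U: "unitary_mat (2 ^ a * d) U"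
    and q: "(\<Sum>i<d. q i) = 1" "\<And>i. i < d \<Longrightarrow> i \<notin> B \<Longrightarrow> q i = 0"
    and err: "trace_norm (alg_output a d Q alg U - diag_of d (\<lambda>i. complex_of_real (q i))) \<le> \<epsilon>"
  shows "1 - \<epsilon> / 2 \<le> (l2 {n. n < env_dim alg * (2 ^ a * d) \<and> n mod d \<in> B} (vec_after a alg U Q))\<^sup>2"
proof -
  let ?N = "env_dim alg * (2 ^ a * d)"
  let ?S = "{n. n < ?N \<and> n mod d \<in> B}"
  let ?v = "vec_after a alg U Q"
  let ?out = "alg_output a d Q alg U"
  let ?\<rho> = "diag_of d (\<lambda>i. complex_of_real (q i))"
  define w where "w i = (if i \<in> B then - 1 else 1 :: real)" for i
  have D: "?out - ?\<rho> \<in> carrier_mat d d" by (rule minus_carrier_mat) simp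
  have "mat_adjoint (?out - ?\<rho>) = ?out - ?\<rho>"
  proof (intro eq_matI)
    fix i j assume "i < dim_row (?out - ?\<rho>)" "j < dim_col (?out - ?\<rho>)"
    then have ij: "i < d" "j < d" by auto
    have "mat_adjoint ?out $$ (i, j) = ?out $$ (i, j)"
      by (simp add: mat_adjoint_alg_output[OF alg U])
    then show "mat_adjoint (?out - ?\<rho>) $$ (i, j) = (?out - ?\<rho>) $$ (i, j)"
      using ij by (simp add: carrier_matD[OF alg_output_carrier])
  qed (auto simp: carrier_matD[OF alg_output_carrier])
  then have "(\<Sum>i<d. w i * Re ((?out - ?\<rho>) $$ (i, i))) \<le> trace_norm (?out - ?\<rho>)"
    by (intro trace_norm_ge_weighted_diag D) (auto simp: w_def)
  also have "(\<Sum>i<d. w i * Re ((?out - ?\<rho>) $$ (i, i)))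
      = (\<Sum>i<d. w i * Re (?out $$ (i, i))) - (\<Sum>i<d. w i * q i)"
    by (simp add: carrier_matD[OF alg_output_carrier] right_diff_distrib sum_subtractf)
  also have "(\<Sum>i<d. w i * q i) = (\<Sum>i<d. - q i)"
    using q(2) by (intro sum.cong) (auto simp: w_def)
  also have "\<dots> = - 1" using q(1) by (simp add: sum_negf)
  \<comment> \<open>\<open>w\<close> is 1 minus twice the indicator of \<open>B\<close>, so this is
    the total weight, which equals 1, minus twice the block weight.\<close>
  also have "(\<Sum>i<d. w i * Re (?out $$ (i, i)))
      = (\<Sum>n<?N. (cmod (?v $ n))\<^sup>2 - (if n \<in> ?S then 2 * (cmod (?v $ n))\<^sup>2 else 0))"
    unfolding weighted_diag_alg_output[OF alg U] by (intro sum.cong) (auto simp: w_def)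
  also have "\<dots> = (l2 {..<?N} ?v)\<^sup>2 - (\<Sum>n<?N. if n \<in> ?S then 2 * (cmod (?v $ n))\<^sup>2 else 0)"
    by (simp add: sum_subtractf l2_square)
  also have "(\<Sum>n<?N. if n \<in> ?S then 2 * (cmod (?v $ n))\<^sup>2 else 0)
      = (\<Sum>n\<in>?S. if n \<in> ?S then 2 * (cmod (?v $ n))\<^sup>2 else 0)"
    by (rule sum.mono_neutral_right) auto
  also have "\<dots> = 2 * (l2 ?S ?v)\<^sup>2" by (simp add: l2_square sum_distrib_left)
  finally show ?thesis using err l2_vec_after[OF alg U order_refl] by simp
qed

section \<open>Averaging over the blocks\<close>

lemma sum_l2_blocks_le:
  fixes g :: "nat \<Rightarrow> nat"
  assumes "l2 {..<N} v = 1"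
  shows "(\<Sum>x<k. (l2 {n. n < N \<and> g n = x} v)\<^sup>2) \<le> 1"
proof -
  \<comment> \<open>Adding all values of \<open>g\<close> to the index set makes the fibres of
    \<open>g\<close> a partition of all coordinates, including those whose value is not below
    \<open>k\<close>.\<close>
  have "(\<Sum>x<k. (l2 {n. n < N \<and> g n = x} v)\<^sup>2)
      \<le> (\<Sum>x\<in>{..<k} \<union> g ` {..<N}. (l2 {n. n < N \<and> g n = x} v)\<^sup>2)"
    by (rule sum_mono2) auto
  also have "\<dots> = (\<Sum>x\<in>{..<k} \<union> g ` {..<N}. \<Sum>n | n \<in> {..<N} \<and> g n = x. (cmod (v $ n))\<^sup>2)"
    by (simp add: l2_square)
  also have "\<dots> = (\<Sum>n<N. (cmod (v $ n))\<^sup>2)"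
    by (rule sum.group) auto
  also have "\<dots> = 1" using assms by (simp flip: l2_square)
  finally show ?thesis .
qed

text \<open>Cauchy-Schwarz against the constant function 1.\<close>

lemma sum_le_sqrt_card:
  fixes f :: "nat \<Rightarrow> real"
  assumes "(\<Sum>x<k. (f x)\<^sup>2) \<le> 1"
  shows "(\<Sum>x<k. f x) \<le> sqrt k"
proof -
  have "(\<Sum>x<k. f x) \<le> (\<Sum>x<k. \<bar>f x\<bar> * \<bar>1\<bar>)" by (intro sum_mono) auto
  also have "\<dots> \<le> L2_set f {..<k} * L2_set (\<lambda>_. 1) {..<k}" by (rule L2_set_mult_ineq)
  also have "\<dots> \<le> 1 * sqrt k"
    using assms by (intro mult_mono) (auto simp: L2_set_def sum_nonneg)
  finally show ?thesis by simp
qed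

text \<open>The estimate \<open>main\<close> for a single block is summed over all blocks; then
  \<open>k = d div r\<close> is converted into \<open>d / r\<close>, keeping track of the
  constants.\<close>

lemma query_lower_bound:
  assumes r: "1 \<le> r" "real r \<le> real d / 2" and a: "1 \<le> a" and \<epsilon>: "\<epsilon> < 1"
    and \<alpha>: "0 < \<alpha>" "lam \<le> \<alpha>"
    and \<rho>0: "rank_state d r \<rho>0" "lambda_max \<rho>0 = lam"
    and alg: "query_algorithm a d Q alg"
    and correct: "\<And>\<rho> U. rank_state d r \<rho> \<Longrightarrow> lambda_max \<rho> = lam \<Longrightarrow> block_encoding \<alpha> a d U \<rho> \<Longrightarrow>
      trace_norm (alg_output a d Q alg U - \<rho>) \<le> \<epsilon>"
  shows "1 / 8 * (\<alpha> / lam) * sqrt (real d / real r) * (1 - \<epsilon>) \<le> real Q"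
proof -
  obtain p :: "nat \<Rightarrow> real" where p: "\<And>j. j < r \<Longrightarrow> 0 < p j" "(\<Sum>j<r. p j) = 1"
    "Max (p ` {..<r}) = lam"
    using rank_state_spectrum[OF \<rho>0(1)] \<rho>0(2) by metis
  have r0: "0 < r" using r by simp
  have pl: "p j \<le> lam" if "j < r" for j
    using that p(3) by (metis Max_ge finite_imageI finite_lessThan imageI lessThan_iff)
  have lam: "0 < lam" using pl[OF r0] p(1)[OF r0] by linarith
  define k where "k = d div r"
  define N where "N = env_dim alg * (2 ^ a * d)"
  define S where "S x = {n. n < N \<and> n mod d div r = x}" for x
  define \<kappa> where "\<kappa> = sqrt 2 * (lam / \<alpha>)"
  define U where "U x = refl_mat (2 ^ a) d (\<lambda>i. block_spectrum r p x i / \<alpha>)" for x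
  define V where "V = refl_mat (2 ^ a) d (\<lambda>_. 0)"
  define \<psi> where "\<psi> t = vec_after a alg V t" for t
  have m: "(2::nat) \<le> 2 ^ a" using power_increasing[of 1 a "2::nat"] a by simp
  have q: "\<bar>block_spectrum r p x i\<bar> \<le> lam" for x i
    using pl[of "i mod r"] p(1)[of "i mod r"] r0 lam
    by (auto simp: block_spectrum_def abs_if less_imp_le not_less)
  then have q\<alpha>: "\<bar>block_spectrum r p x i\<bar> \<le> \<alpha>" for x i using \<alpha> order_trans by blast
  have UU: "unitary_mat (2 ^ a * d) (U x)" for x
    unfolding U_def using q\<alpha> \<alpha> by (intro unitary_refl_mat m) auto
  have VV: "unitary_mat (2 ^ a * d) V"
    unfolding V_def by (intro unitary_refl_mat m) auto
  have \<kappa>0: "0 \<le> \<kappa>" using lam \<alpha> by (simp add: \<kappa>_def)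
  have \<psi>: "\<psi> t \<in> carrier_vec N" "l2 {..<N} (\<psi> t) = 1" if "t \<le> Q" for t
    using vec_after_carrier[OF alg VV that] l2_vec_after[OF alg VV that] by (auto simp: \<psi>_def N_def)
  \<comment> \<open>Correctness forces weight \<open>1 - \<epsilon> / 2\<close> on block
    \<open>x\<close>; whatever the reference run lacks there has to come from the hybrid
    error.\<close>
  have main: "1 - \<epsilon> / 2 \<le> (l2 (S x) (\<psi> Q))\<^sup>2 + 2 * (\<kappa> * (\<Sum>t<Q. l2 (S x) (\<psi> t)))"
    if x: "x < k" for x
  proof -
    let ?\<phi> = "vec_after a alg (U x) Q"
    let ?\<delta> = "l2 {..<N} (?\<phi> - \<psi> Q)"
    note st = block_state[OF p r0 x[unfolded k_def]]
    have \<phi>: "?\<phi> \<in> carrier_vec N" "l2 {..<N} ?\<phi> = 1"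
      using vec_after_carrier[OF alg UU order_refl] l2_vec_after[OF alg UU order_refl]
      by (auto simp: N_def)
    have "trace_norm (alg_output a d Q alg (U x)
        - diag_of d (\<lambda>i. complex_of_real (block_spectrum r p x i))) \<le> \<epsilon>"
      unfolding U_def by (intro correct st(1,2) block_encoding_refl_mat \<alpha>(1) q\<alpha> a)
    then have ge: "1 - \<epsilon> / 2 \<le> (l2 (S x) ?\<phi>)\<^sup>2"
      using l2_block_ge[OF alg UU st(3), where B = "{i. i div r = x}"]
      by (auto simp: S_def N_def block_spectrum_def)
    have \<delta>: "?\<delta> \<le> \<kappa> * (\<Sum>t<Q. l2 (S x) (\<psi> t))"
      unfolding N_def \<psi>_def
    proof (rule l2_hybrid[OF alg UU _ VV])
      show "mat_adjoint (U x) = U x" "mat_adjoint V = V"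
        by (auto simp: U_def V_def mat_adjoint_refl_mat)
      fix \<phi> :: "complex vec" assume \<phi>: "\<phi> \<in> carrier_vec (env_dim alg * (2 ^ a * d))"
      have "\<bar>block_spectrum r p x i / \<alpha>\<bar> \<le> lam / \<alpha>" for i
        using q \<alpha> by (simp add: divide_right_mono)
      moreover have "block_spectrum r p x i / \<alpha> = 0" if "i \<notin> {i. i div r = x}" for i
        using that by (simp add: block_spectrum_def)
      moreover have "lam / \<alpha> \<le> 1" using \<alpha> by simp
      ultimately show "l2 {..<env_dim alg * (2 ^ a * d)}
          (kron (1\<^sub>m (env_dim alg)) (U x) *\<^sub>v \<phi> - kron (1\<^sub>m (env_dim alg)) V *\<^sub>v \<phi>) \<le> \<kappa> * l2 (S x) \<phi>"
        using l2_refl_mat_minus[OF m _ _ _ \<phi>, of "{i. i div r = x}"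
            "\<lambda>i. block_spectrum r p x i / \<alpha>" "lam / \<alpha>"]
        unfolding U_def V_def \<kappa>_def S_def N_def by simp
    qed simp
    have SN: "S x \<subseteq> {..<N}" by (auto simp: S_def)
    have "l2 (S x) ?\<phi> \<le> l2 (S x) (\<psi> Q) + l2 (S x) (?\<phi> - \<psi> Q)"
      by (rule l2_le_add_minus[OF SN \<phi>(1) \<psi>(1)]) simp
    also have "l2 (S x) (?\<phi> - \<psi> Q) \<le> ?\<delta>" using SN by (intro l2_mono) auto
    finally have diff: "l2 (S x) ?\<phi> - l2 (S x) (\<psi> Q) \<le> ?\<delta>" by simp
    have "l2 (S x) ?\<phi> \<le> 1" "l2 (S x) (\<psi> Q) \<le> 1"
      using l2_mono[OF _ SN, of ?\<phi>] l2_mono[OF _ SN, of "\<psi> Q"] \<phi> \<psi>[of Q] by auto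
    \<comment> \<open>A difference of squares is factored; the second factor is at most 2 since both
      vectors have norm 1.\<close>
    then have "(l2 (S x) ?\<phi> - l2 (S x) (\<psi> Q)) * (l2 (S x) ?\<phi> + l2 (S x) (\<psi> Q)) \<le> ?\<delta> * 2"
      using diff by (intro mult_mono) auto
    then have "(l2 (S x) ?\<phi>)\<^sup>2 - (l2 (S x) (\<psi> Q))\<^sup>2 \<le> 2 * ?\<delta>"
      by (simp add: power2_eq_square algebra_simps)
    then show ?thesis using ge \<delta> by linarith
  qed
  have blocks: "(\<Sum>x<k. (l2 (S x) (\<psi> t))\<^sup>2) \<le> 1" if "t \<le> Q" for t
    unfolding S_def using sum_l2_blocks_le[OF \<psi>(2)[OF that]] .
  have "real k * (1 - \<epsilon> / 2)
      \<le> (\<Sum>x<k. (l2 (S x) (\<psi> Q))\<^sup>2 + 2 * (\<kappa> * (\<Sum>t<Q. l2 (S x) (\<psi> t))))"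
    using sum_mono[of "{..<k}" "\<lambda>_. 1 - \<epsilon> / 2", OF main] by simp
  \<comment> \<open>With the sum over blocks innermost, Cauchy-Schwarz applies to each query
    separately.\<close>
  also have "\<dots> = (\<Sum>x<k. (l2 (S x) (\<psi> Q))\<^sup>2) + 2 * \<kappa> * (\<Sum>t<Q. \<Sum>x<k. l2 (S x) (\<psi> t))"
    by (subst sum.swap) (simp add: sum.distrib sum_distrib_left mult.assoc)
  also have "\<dots> \<le> 1 + 2 * \<kappa> * (\<Sum>t<Q. sqrt k)"
    using blocks \<kappa>0 by (intro add_mono mult_left_mono sum_mono sum_le_sqrt_card) auto
  finally have sum_le: "real k * (1 - \<epsilon> / 2) \<le> 1 + 2 * \<kappa> * (real Q * sqrt k)" by simp
  have "2 * r \<le> d" using r by linarith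
  then have "2 * r div r \<le> k" unfolding k_def by (rule div_le_mono)
  then have k2: "2 \<le> k" using r0 by simp
  \<comment> \<open>Since \<open>2 \<le> k\<close>, the additive 1 is at most \<open>k / 2\<close>;
    splitting this off turns the factor \<open>1 - \<epsilon> / 2\<close> into
    \<open>(1 - \<epsilon>) / 2\<close>.\<close>
  have "real k / 2 * (1 - \<epsilon>) = real k * (1 - \<epsilon> / 2) - real k / 2"
    by (simp add: field_simps)
  also have "\<dots> \<le> real k * (1 - \<epsilon> / 2) - 1" using k2 by simp
  finally have "real k / 2 * (1 - \<epsilon>) \<le> real k * (1 - \<epsilon> / 2) - 1" .
  then have "real k * (1 - \<epsilon>) \<le> 4 * \<kappa> * real Q * sqrt k" using sum_le by simp
  then have "sqrt k * (sqrt k * (1 - \<epsilon>)) \<le> sqrt k * (4 * \<kappa> * real Q)"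
    by (simp add: mult_ac flip: mult.assoc[of "sqrt k" "sqrt k"])
  then have root: "sqrt k * (1 - \<epsilon>) \<le> 4 * \<kappa> * real Q" using k2 by simp
  \<comment> \<open>Rounding down in \<open>d div r\<close> costs at most a factor of 2.\<close>
  have "d < (k + 1) * r" using r0 by (simp add: k_def dividend_less_div_times add.commute)
  also have "\<dots> \<le> (2 * k) * r" using k2 by (intro mult_le_mono1) simp
  finally have "real d \<le> real ((2 * k) * r)" by linarith
  then have "real d / real r \<le> 2 * real k" using r0 by (simp add: divide_le_eq)
  then have "sqrt (real d / real r) \<le> sqrt 2 * sqrt k"
    by (simp flip: real_sqrt_mult)
  then have "sqrt (real d / real r) * (1 - \<epsilon>) \<le> sqrt 2 * sqrt k * (1 - \<epsilon>)"
    using \<epsilon> by (intro mult_right_mono) auto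
  also have "\<dots> \<le> sqrt 2 * (4 * \<kappa> * real Q)"
    using root by (simp add: mult.assoc)
  \<comment> \<open>One \<open>sqrt 2\<close> from \<kappa> and one from the rounding combine with 4
    to 8.\<close>
  also have "\<dots> = 8 * (lam / \<alpha>) * real Q"
    by (simp add: \<kappa>_def)
  finally have "sqrt (real d / real r) * (1 - \<epsilon>) \<le> 8 * (lam / \<alpha>) * real Q" .
  then have "\<alpha> / lam * (sqrt (real d / real r) * (1 - \<epsilon>)) \<le> \<alpha> / lam * (8 * (lam / \<alpha>) * real Q)"
    using \<alpha> lam by (intro mult_left_mono) auto
  also have "\<dots> = 8 * real Q" using \<alpha> lam by simp
  finally have le: "\<alpha> / lam * (sqrt (real d / real r) * (1 - \<epsilon>)) \<le> 8 * real Q" .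
  have "t / 8 \<le> real Q" if "t \<le> 8 * real Q" for t using that by simp
  from this[OF le] show ?thesis by (simp add: mult_ac)
qed

text \<open>The witness for \<open>c\<close> is \<open>1 / 8\<close>, the constant produced by
  \<open>query_lower_bound\<close>.\<close>

theorem theorem4:
  shows "\<exists>c::real. c > 0 \<and>
    (\<forall>(d::nat) (r::nat) (a::nat) (\<epsilon>::real) (\<alpha>::real) (lam::real) (Q::nat) (alg::query_alg).
       1 \<le> r \<and> real r \<le> real d / 2 \<and> 1 \<le> a \<and> 0 < \<epsilon> \<and> \<epsilon> < 1 \<and> 0 < \<alpha> \<and> lam \<le> \<alpha> \<and>
       (\<exists>\<rho>. rank_state d r \<rho> \<and> lambda_max \<rho> = lam) \<and>
       query_algorithm a d Q alg \<and>
       (\<forall>\<rho> U. rank_state d r \<rho> \<and> lambda_max \<rho> = lam \<and> block_encoding \<alpha> a d U \<rho> \<longrightarrow>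
          trace_norm (alg_output a d Q alg U - \<rho>) \<le> \<epsilon>)
       \<longrightarrow> real Q \<ge> c * (\<alpha> / lam) * sqrt (real d / real r) * (1 - \<epsilon>))"
proof (intro exI[of _ "1 / 8"] conjI allI impI; (elim conjE exE)?)
  fix d r a :: nat and \<epsilon> \<alpha> lam :: real and Q :: nat and alg :: query_alg and \<rho>
  assume "1 \<le> r" "real r \<le> real d / 2" "1 \<le> a" "\<epsilon> < 1" "0 < \<alpha>" "lam \<le> \<alpha>"
    "rank_state d r \<rho>" "lambda_max \<rho> = lam" "query_algorithm a d Q alg"
    and "\<forall>\<rho> U. rank_state d r \<rho> \<and> lambda_max \<rho> = lam \<and> block_encoding \<alpha> a d U \<rho> \<longrightarrow>
          trace_norm (alg_output a d Q alg U - \<rho>) \<le> \<epsilon>"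
  then show "1 / 8 * (\<alpha> / lam) * sqrt (real d / real r) * (1 - \<epsilon>) \<le> real Q"
    by (intro query_lower_bound) blast+
qed simp

end
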